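(* Let $\{\lambda_k\}_{k\in\mathbb Z}$ be a bounded sequence of complex numbers, $\lambda(x)=\sum_{k\in\mathbb Z}\lambda_ke^{ikx}$ the corresponding distribution on $\mathbb T=\mathbb R/(2\pi\mathbb Z)$, and $\operatorname{Conv}_\lambda$ the convolution operator on $L^2(\mathbb T)$, i.e. $\operatorname{Conv}_\lambda\big(\sum_k f_ke^{ikx}\big)=\sum_k\lambda_kf_ke^{ikx}$. Then $$\|\operatorname{Conv}_\lambda\|_\mu^2=\rho(\lambda),\qquad \rho(\lambda)=\limsup_{\#I\to\infty}\frac1{\#I}\sum_{k\in I}|\lambda_k|^2,$$ where $I$ ranges over finite integer intervals $I=\{n,n+1,\dots,m\}\subset\mathbb Z$.
   Context: Here $\mathcal X=\mathbb T$ with $d\mu=\frac1{2\pi}dx$ and $\mathcal H=L^2(\mathbb T,\mu)$ (complex-valued). The limsup is $\lim_{N\to\infty}\sup_{\#I\ge N}$ over all integer intervals $I$, where $\#I$ is the number of points. For measurable $X\subset\mathbb T$, $\pi_X:\mathcal H\to\mathcal H$ is the orthogonal projector $\pi_Xf=\mathbf 1_X f$. A partition is a finite family $\chi=\{Y_1,\dots,Y_J\}$ of measurable sets with $\mu(\mathbb T\setminus\bigcup_j Y_j)=0$ and $\mu(Y_j\cap Y_k)=0$ for $j\ne k$. For a bounded operator $W$ on $\mathcal H$ with operator norm $\|W\|$, put $\mathcal M_\chi(W)=\sum_{j=1}^J\mu(Y_j)\|W\pi_{Y_j}\|^2$, and define the $\mu$-norm $\|W\|_\mu=\inf_\chi\sqrt{\mathcal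 M_\chi(W)}$, the infimum being over all partitions $\chi$. *)

theory Defs
  imports "HOL-Analysis.Analysis"
begin

text \<open>The torus is represented by its fundamental domain \<open>[0, 2\<pi>)\<close>, with the normalised
  Lebesgue measure \<open>dx / 2\<pi>\<close>. Functions on the torus are functions on the reals of which only
  the restriction to this domain matters.\<close>

definition torus :: "real measure" where
  "torus = density (lebesgue_on {0..<2*pi}) (\<lambda>_. ennreal (1 / (2*pi)))"

lemma space_torus: "space torus = {0..<2*pi}"
  by (simp add: torus_def)

lemma measurable_torus_continuous:
  fixes f :: "real \<Rightarrow> complex"
  assumes "continuous_on UNIV f"
  shows "f \<in> borel_measurable torus"
proof -
  have "f \<in> borel_measurable (lebesgue_on {0..<2*pi})"
    by (rule continuous_imp_measurable_on_sets_lebesgue)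
       (use assms continuous_on_subset in auto)
  then show ?thesis by (simp add: torus_def)
qed

lemma emeasure_torus: "emeasure torus (space torus) = 1"
proof -
  have "emeasure torus (space torus)
      = ennreal (1 / (2*pi)) * emeasure (lebesgue_on {0..<2*pi}) {0..<2*pi}"
    unfolding space_torus unfolding torus_def
    by (subst emeasure_density_const) (auto simp: sets_restrict_space)
  also have "emeasure (lebesgue_on {0..<2*pi}) {0..<2*pi} = ennreal (2*pi)"
    by (simp add: emeasure_restrict_space)
  finally show ?thesis
    by (simp add: ennreal_mult[symmetric] del: ennreal_mult'')
qed

lemma finite_measure_torus: "finite_measure torus"
  by (rule finite_measureI) (simp add: emeasure_torus)


definition sq_integrable :: "(real \<Rightarrow> complex) \<Rightarrow> bool" where
  "sq_integrable f \<longleftrightarrow>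
     f \<in> borel_measurable torus \<and> integrable torus (\<lambda>x. (cmod (f x))\<^sup>2)"

lemma sq_integrable_zero: "sq_integrable (\<lambda>_. 0)"
  by (simp add: sq_integrable_def)

lemma sq_integrable_cmult:
  assumes "sq_integrable f" shows "sq_integrable (\<lambda>x. c * f x)"
  using assms by (auto simp: sq_integrable_def norm_mult power_mult_distrib)

lemma sq_integrable_add:
  assumes "sq_integrable f" "sq_integrable g"
  shows "sq_integrable (\<lambda>x. f x + g x)"
proof -
  have meas: "f \<in> borel_measurable torus" "g \<in> borel_measurable torus"
    using assms by (auto simp: sq_integrable_def)
  have "integrable torus (\<lambda>x. 2 * (cmod (f x))\<^sup>2 + 2 * (cmod (g x))\<^sup>2)"
    using assms by (auto simp: sq_integrable_def)
  moreover have "(cmod (f x + g x))\<^sup>2 \<le> 2 * (cmod (f x))\<^sup>2 + 2 * (cmod (g x))\<^sup>2" for x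
  proof -
    have "(cmod (f x + g x))\<^sup>2 \<le> (cmod (f x) + cmod (g x))\<^sup>2"
      by (intro power_mono norm_triangle_ineq) auto
    also have "\<dots> \<le> 2 * (cmod (f x))\<^sup>2 + 2 * (cmod (g x))\<^sup>2"
      using sum_squares_bound[of "cmod (f x)" "cmod (g x)"] by (simp add: power2_sum)
    finally show ?thesis .
  qed
  ultimately have "integrable torus (\<lambda>x. (cmod (f x + g x))\<^sup>2)"
    using meas by (elim Bochner_Integration.integrable_bound) (auto intro!: AE_I2)
  with meas show ?thesis by (auto simp: sq_integrable_def)
qed

lemma sq_integrable_diff:
  assumes "sq_integrable f" "sq_integrable g"
  shows "sq_integrable (\<lambda>x. f x - g x)"
  using sq_integrable_add[OF assms(1) sq_integrable_cmult[OF assms(2), of "-1"]] by simp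

lemma sq_integrable_indicator:
  assumes "sq_integrable f" "Y \<in> sets torus"
  shows "sq_integrable (\<lambda>x. indicator Y x * f x)"
proof -
  have meas: "(\<lambda>x. indicator Y x * f x) \<in> borel_measurable torus"
    using assms by (auto simp: sq_integrable_def)
  have "integrable torus (\<lambda>x. (cmod (indicator Y x * f x))\<^sup>2)"
    by (rule Bochner_Integration.integrable_bound[of _ "\<lambda>x. (cmod (f x))\<^sup>2"])
       (use assms meas in \<open>auto simp: sq_integrable_def indicator_def\<close>)
  with meas show ?thesis by (simp add: sq_integrable_def)
qed

lemma integrable_mult_cnj:
  assumes "sq_integrable f" "sq_integrable g"
  shows "integrable torus (\<lambda>x. f x * cnj (g x))"
proof -
  have meas: "f \<in> borel_measurable torus" "g \<in> borel_measurable torus"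
    using assms by (auto simp: sq_integrable_def)
  have "integrable torus (\<lambda>x. (cmod (f x))\<^sup>2 + (cmod (g x))\<^sup>2)"
    using assms by (auto simp: sq_integrable_def)
  moreover have "cmod (f x * cnj (g x)) \<le> (cmod (f x))\<^sup>2 + (cmod (g x))\<^sup>2" for x
    using sum_squares_bound[of "cmod (f x)" "cmod (g x)"]
      mult_nonneg_nonneg[OF norm_ge_zero[of "f x"] norm_ge_zero[of "g x"]]
    unfolding norm_mult complex_mod_cnj by linarith
  moreover have "(\<lambda>x. f x * cnj (g x)) \<in> borel_measurable torus"
  proof -
    have "(\<lambda>x. cnj (g x)) \<in> borel_measurable torus"
      using meas(2) by (intro borel_measurable_continuous_on[of cnj]) (auto intro: continuous_intros)
    then show ?thesis using meas(1) by simp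
  qed
  ultimately show ?thesis
    by (elim Bochner_Integration.integrable_bound) (auto intro!: AE_I2)
qed

lemma sq_integrable_cis: "sq_integrable (\<lambda>x. cis (of_int k * x))"
proof -
  interpret finite_measure torus by (rule finite_measure_torus)
  have "(\<lambda>x. cis (of_int k * x)) \<in> borel_measurable torus"
    by (intro measurable_torus_continuous continuous_intros)
  then show ?thesis by (simp add: sq_integrable_def)
qed


text \<open>The Hilbert space \<open>L\<^sup>2\<close> of square-integrable functions modulo equality almost everywhere.\<close>

definition ae_eq :: "(real \<Rightarrow> complex) \<Rightarrow> (real \<Rightarrow> complex) \<Rightarrow> bool" where
  "ae_eq f g \<longleftrightarrow> sq_integrable f \<and> sq_integrable g \<and> (AE x in torus. f x = g x)"

quotient_type L2 = "real \<Rightarrow> complex" / partial: ae_eq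
proof (rule part_equivpI)
  show "\<exists>f. ae_eq f f"
    using sq_integrable_zero by (auto simp: ae_eq_def)
  show "symp ae_eq"
    by (auto simp: symp_def ae_eq_def eq_commute)
  show "transp ae_eq"
    by (auto simp: transp_def ae_eq_def)
qed

instantiation L2 :: real_vector
begin

lift_definition zero_L2 :: L2 is "\<lambda>_. 0"
  by (simp add: ae_eq_def sq_integrable_zero)

lift_definition plus_L2 :: "L2 \<Rightarrow> L2 \<Rightarrow> L2" is "\<lambda>f g x. f x + g x"
  by (auto simp: ae_eq_def sq_integrable_add)

lift_definition uminus_L2 :: "L2 \<Rightarrow> L2" is "\<lambda>f x. - f x"
  by (auto simp: ae_eq_def sq_integrable_def)

lift_definition minus_L2 :: "L2 \<Rightarrow> L2 \<Rightarrow> L2" is "\<lambda>f g x. f x - g x"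
proof -
  fix f f' g g' assume "ae_eq f f'" "ae_eq g g'"
  then show "ae_eq (\<lambda>x. f x - g x) (\<lambda>x. f' x - g' x)"
    by (auto simp: ae_eq_def sq_integrable_diff)
qed

lift_definition scaleR_L2 :: "real \<Rightarrow> L2 \<Rightarrow> L2" is "\<lambda>c f x. of_real c * f x"
  by (auto simp: ae_eq_def sq_integrable_cmult)

instance
proof
  fix f g h :: L2 and a b :: real
  show "f + g + h = f + (g + h)"
    by transfer (auto simp: ae_eq_def add.assoc intro: sq_integrable_add)
  show "f + g = g + f"
    by transfer (auto simp: ae_eq_def add.commute intro: sq_integrable_add)
  show "0 + f = f"
    by transfer (auto simp: ae_eq_def)
  show "- f + f = 0"
    by transfer (auto simp: ae_eq_def sq_integrable_zero)
  show "f - g = f + - g"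
    by transfer (simp add: ae_eq_def sq_integrable_diff)
  show "a *\<^sub>R (f + g) = a *\<^sub>R f + a *\<^sub>R g"
    by transfer (auto simp: ae_eq_def distrib_left intro!: sq_integrable_add sq_integrable_cmult)
  show "(a + b) *\<^sub>R f = a *\<^sub>R f + b *\<^sub>R f"
    by transfer (auto simp: ae_eq_def distrib_right intro!: sq_integrable_add sq_integrable_cmult)
  show "a *\<^sub>R b *\<^sub>R f = (a * b) *\<^sub>R f"
  proof (transfer, goal_cases)
    case (1 a b f)
    then show ?case
      using sq_integrable_cmult[of f "of_real a * of_real b"]
      by (auto simp: ae_eq_def mult.assoc)
  qed
  show "1 *\<^sub>R f = f"
    by transfer (auto simp: ae_eq_def)
qed

end

text \<open>The class \<open>real_inner\<close> asks for a real inner product: it is the real part of the usual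
  complex one and induces the same norm.\<close>

instantiation L2 :: real_inner
begin

lift_definition inner_L2 :: "L2 \<Rightarrow> L2 \<Rightarrow> real" is "\<lambda>f g. Re (LINT x|torus. f x * cnj (g x))"
proof -
  fix f f' g g' assume h: "ae_eq f f'" "ae_eq g g'"
  have "(LINT x|torus. f x * cnj (g x)) = (LINT x|torus. f' x * cnj (g' x))"
    by (intro integral_cong_AE borel_measurable_integrable integrable_mult_cnj)
       (use h in \<open>auto simp: ae_eq_def\<close>)
  then show "Re (LINT x|torus. f x * cnj (g x)) = Re (LINT x|torus. f' x * cnj (g' x))" 
    by simp
qed

lift_definition norm_L2 :: "L2 \<Rightarrow> real" is "\<lambda>f. sqrt (LINT x|torus. (cmod (f x))\<^sup>2)"
proof -
  fix f g assume "ae_eq f g"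
  then have "(LINT x|torus. (cmod (f x))\<^sup>2) = (LINT x|torus. (cmod (g x))\<^sup>2)"
    by (intro integral_cong_AE) (auto simp: ae_eq_def sq_integrable_def)
  then show "sqrt (LINT x|torus. (cmod (f x))\<^sup>2) = sqrt (LINT x|torus. (cmod (g x))\<^sup>2)"
    by simp
qed

definition "sgn (f::L2) = f /\<^sub>R norm f"
definition "dist (f::L2) g = norm (f - g)"
definition "uniformity = (INF e\<in>{0<..}. principal {(f::L2, g). dist f g < e})"
definition "open U \<longleftrightarrow> (\<forall>f::L2\<in>U. \<forall>\<^sub>F (f', g) in uniformity. f' = f \<longrightarrow> g \<in> U)"

instance
proof
  fix f g h :: L2 and a :: real and U :: "L2 set"
  show "sgn f = f /\<^sub>R norm f" by (rule sgn_L2_def)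
  show "dist f g = norm (f - g)" by (rule dist_L2_def)
  show "uniformity = (INF e\<in>{0<..}. principal {(f::L2, g). dist f g < e})"
    by (rule uniformity_L2_def)
  show "open U = (\<forall>f\<in>U. \<forall>\<^sub>F (f', g) in uniformity. f' = f \<longrightarrow> g \<in> U)"
    by (rule open_L2_def)
  have inner_self: "(LINT x|torus. u x * cnj (u x)) = of_real (LINT x|torus. (cmod (u x))\<^sup>2)" for u
    by (simp only: complex_norm_square[symmetric] integral_complex_of_real)
  show "inner f g = inner g f"
  proof (transfer, goal_cases)
    case (1 f g)
    have "(LINT x|torus. g x * cnj (f x)) = (LINT x|torus. cnj (f x * cnj (g x)))"
      by (simp add: mult.commute)
    also have "\<dots> = cnj (LINT x|torus. f x * cnj (g x))"
      by (rule Bochner_Integration.integral_cnj)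
    finally show ?case by simp
  qed
  show "inner (f + g) h = inner f h + inner g h"
    by transfer (simp add: ae_eq_def distrib_right integrable_mult_cnj)
  show "inner (a *\<^sub>R f) g = a * inner f g"
    by transfer (simp add: mult.assoc)
  show "0 \<le> inner f f"
    by transfer (simp add: inner_self)
  show "inner f f = 0 \<longleftrightarrow> f = 0"
  proof (transfer, goal_cases)
    case (1 f)
    then have sq: "sq_integrable f" by (simp add: ae_eq_def)
    then have "(LINT x|torus. (cmod (f x))\<^sup>2) = 0 \<longleftrightarrow> (AE x in torus. (cmod (f x))\<^sup>2 = 0)"
      by (intro integral_nonneg_eq_0_iff_AE) (auto simp: sq_integrable_def)
    with sq show ?case by (simp add: inner_self ae_eq_def sq_integrable_zero)
  qed
  show "norm f = sqrt (inner f f)"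
    by transfer (simp add: inner_self)
qed

end

lift_definition scaleC_L2 :: "complex \<Rightarrow> L2 \<Rightarrow> L2" is "\<lambda>c f x. c * f x"
  by (auto simp: ae_eq_def sq_integrable_cmult)

text \<open>The exponentials \<open>x \<mapsto> e^{ikx}\<close> and the coefficients \<open>f_k\<close> of \<open>f = \<Sum> f_k e^{ikx}\<close>.\<close>

lift_definition expo :: "int \<Rightarrow> L2" is "\<lambda>k x. cis (of_int k * x)"
  by (simp add: ae_eq_def sq_integrable_cis)

lift_definition fourier_coeff :: "L2 \<Rightarrow> int \<Rightarrow> complex"
  is "\<lambda>f k. LINT x|torus. f x * cis (- (of_int k * x))"
proof (rule ext)
  fix f g :: "real \<Rightarrow> complex" and k :: int
  assume h: "ae_eq f g"
  have "(LINT x|torus. f x * cnj (cis (of_int k * x)))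
      = (LINT x|torus. g x * cnj (cis (of_int k * x)))"
    by (intro integral_cong_AE borel_measurable_integrable integrable_mult_cnj sq_integrable_cis)
       (use h in \<open>auto simp: ae_eq_def\<close>)
  then show "(LINT x|torus. f x * cis (- (of_int k * x)))
      = (LINT x|torus. g x * cis (- (of_int k * x)))"
    by (simp add: cis_cnj)
qed

text \<open>The infinite sum is that of the norm topology of \<^typ>\<open>L2\<close>.\<close>

definition Conv :: "(int \<Rightarrow> complex) \<Rightarrow> L2 \<Rightarrow> L2" where
  "Conv lam f = (\<Sum>\<^sub>\<infinity>k. scaleC_L2 (lam k * fourier_coeff f k) (expo k))"

text \<open>The projector \<open>\<pi>_Y\<close>; its value for a non-measurable \<open>Y\<close> is a dummy.\<close>

lift_definition cutoff :: "real set \<Rightarrow> L2 \<Rightarrow> L2"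
  is "\<lambda>Y f. if Y \<in> sets torus then (\<lambda>x. indicator Y x * f x) else (\<lambda>_. 0)"
  by (auto simp: ae_eq_def sq_integrable_indicator sq_integrable_zero)

definition is_partition :: "nat \<Rightarrow> (nat \<Rightarrow> real set) \<Rightarrow> bool" where
  "is_partition J Y \<longleftrightarrow>
     (\<forall>j\<in>{1..J}. Y j \<in> sets torus) \<and>
     measure torus (space torus - (\<Union>j\<in>{1..J}. Y j)) = 0 \<and>
     (\<forall>j\<in>{1..J}. \<forall>k\<in>{1..J}. j \<noteq> k \<longrightarrow> measure torus (Y j \<inter> Y k) = 0)"

definition M_part :: "nat \<Rightarrow> (nat \<Rightarrow> real set) \<Rightarrow> (L2 \<Rightarrow> L2) \<Rightarrow> real" where
  "M_part J Y W = (\<Sum>j=1..J. measure torus (Y j) * (onorm (W \<circ> cutoff (Y j)))\<^sup>2)"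

definition mu_norm :: "(L2 \<Rightarrow> L2) \<Rightarrow> real" where
  "mu_norm W = Inf {sqrt (M_part J Y W) | J Y. is_partition J Y}"

definition rho :: "(int \<Rightarrow> complex) \<Rightarrow> real" where
  "rho lam = lim (\<lambda>N::nat. SUP I \<in> {I. \<exists>n m. n \<le> m \<and> I = {n..m} \<and> N \<le> card I}.
     (1 / real (card I)) * (\<Sum>k\<in>I. (cmod (lam k))\<^sup>2))"

end

theory Submission
  imports Defs
begin

text \<open>By Parseval, \<open>\<parallel>Conv lam f\<parallel>\<^sup>2 = \<Sum> \<bar>lam k\<bar>\<^sup>2 \<bar>f\<^sub>k\<bar>\<^sup>2\<close>. For the lower bound, each operator
  \<open>Conv lam \<circ> \<pi>\<^sub>Y\<close> is tested on \<open>e\<^sup>i\<^sup>n\<^sup>x 1\<^sub>Y\<close>: summing over the partition, \<open>M\<close> dominates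
  \<open>\<Sum>\<^sub>q w\<^sub>q \<bar>lam (n + q)\<bar>\<^sup>2\<close> for every \<open>n\<close>, where \<open>w\<^sub>q = \<Sum>\<^sub>j \<bar>(1\<^sub>Y\<^sub>j)\<^sub>q\<bar>\<^sup>2\<close> are probability weights
  independent of \<open>n\<close>; averaging over \<open>n\<close> in a long interval turns this into the mean of
  \<open>\<bar>lam\<bar>\<^sup>2\<close> over that interval, up to boundary terms. For the upper bound, the torus is cut into \<open>J\<close>
  equal arcs. If \<open>f\<close> lives on an arc of length \<open>2\<pi> / J\<close>, multiplying it by \<open>e\<^sup>i\<^sup>m\<^sup>(\<^sup>x\<^sup>-\<^sup>a\<^sup>)\<close> with
  \<open>0 \<le> m < N\<close> changes it by at most \<open>2\<pi>N / J\<close> in relative norm but shifts the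
  coefficients by \<open>m\<close>; averaging over \<open>m\<close> replaces \<open>\<bar>lam\<bar>\<^sup>2\<close> by its means over intervals of
  length \<open>N\<close>. Then \<open>J \<rightarrow> \<infinity>\<close> and \<open>N \<rightarrow> \<infinity>\<close>.\<close>

section \<open>Trigonometric sums in the Hilbert space\<close>

interpretation torus: finite_measure torus
  by (rule finite_measure_torus)

lemma measure_torus_space: "measure torus (space torus) = 1"
  by (simp add: measure_def emeasure_torus)

lemma ae_eq_refl_iff [simp]: "ae_eq f f \<longleftrightarrow> sq_integrable f"
  by (simp add: ae_eq_def)

lemma L2_cases:
  obtains f where "sq_integrable f" "F = abs_L2 f"
  using Quotient_abs_rep[OF Quotient_L2, of F] Quotient_rep_reflp[OF Quotient_L2, of F] by force

lemma norm_abs_L2: "sq_integrable f \<Longrightarrow> norm (abs_L2 f) = sqrt (LINT x|torus. (cmod (f x))\<^sup>2)"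
  by (simp add: norm_L2.abs_eq)

lemma diff_abs_L2:
  "sq_integrable f \<Longrightarrow> sq_integrable g \<Longrightarrow> abs_L2 f - abs_L2 g = abs_L2 (\<lambda>x. f x - g x)"
  by (simp add: minus_L2.abs_eq)

lemma expo_eq: "expo k = abs_L2 (\<lambda>x. cis (of_int k * x))"
  by (simp add: expo_def)

lemma scaleC_add_left: "scaleC_L2 (c + d) f = scaleC_L2 c f + scaleC_L2 d f"
  by transfer (auto simp: ae_eq_def distrib_right intro!: sq_integrable_add sq_integrable_cmult)

lemma scaleC_0_left [simp]: "scaleC_L2 0 f = 0"
  by transfer (auto simp: ae_eq_def sq_integrable_zero)

lemma scaleC_of_real: "scaleC_L2 (of_real r) f = r *\<^sub>R f"
  by transfer (auto simp: ae_eq_def sq_integrable_cmult)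

lemma norm_scaleC: "norm (scaleC_L2 c f) = cmod c * norm f"
  by transfer (simp add: norm_mult power_mult_distrib real_sqrt_mult)

lemma fourier_coeff_add: "fourier_coeff (f + g) k = fourier_coeff f k + fourier_coeff g k"
proof (transfer fixing: k, goal_cases)
  case (1 f g)
  then have "integrable torus (\<lambda>x. f x * cis (- (of_int k * x)))" "integrable torus (\<lambda>x. g x * cis (- (of_int k * x)))"
    using integrable_mult_cnj[OF _ sq_integrable_cis, of f k] integrable_mult_cnj[OF _ sq_integrable_cis, of g k]
    by (auto simp: cis_cnj)
  then show ?case
    by (simp add: distrib_right)
qed

lemma fourier_coeff_scaleC: "fourier_coeff (scaleC_L2 c f) k = c * fourier_coeff f k"
  by transfer (simp add: mult.assoc)

lemma fourier_coeff_scaleR: "fourier_coeff (r *\<^sub>R f) k = of_real r * fourier_coeff f k"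
  by (metis fourier_coeff_scaleC scaleC_of_real)

lemma fourier_coeff_zero [simp]: "fourier_coeff 0 k = 0"
  by transfer simp

lemma fourier_coeff_diff: "fourier_coeff (f - g) k = fourier_coeff f k - fourier_coeff g k"
  using fourier_coeff_add[of "f - g" g k] by simp

lemma fourier_coeff_sum: "fourier_coeff (sum F A) k = (\<Sum>a\<in>A. fourier_coeff (F a) k)"
  by (induction A rule: infinite_finite_induct) (auto simp: fourier_coeff_add)

lemma integral_torus:
  fixes f :: "real \<Rightarrow> complex"
  assumes "continuous_on UNIV f"
  shows "(LINT x|torus. f x) = integral {0..2*pi} f / (2 * pi)"
proof -
  have meas: "f \<in> borel_measurable (lebesgue_on {0..<2*pi})"
    by (rule continuous_imp_measurable_on_sets_lebesgue)
       (use assms continuous_on_subset in auto)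
  have "{0..<2*pi} \<subseteq> {0..2*pi}"
    by auto
  moreover have "integrable (lebesgue_on {0..2*pi}) f"
    using assms by (intro continuous_imp_integrable_real continuous_on_subset[OF assms]) auto
  ultimately have int: "integrable (lebesgue_on {0..<2*pi}) f"
    using set_integrable_subset[of lebesgue "{0..2*pi}" f "{0..<2*pi}"]
    by (simp add: set_integrable_def integrable_restrict_space)
  have "(LINT x|torus. f x) = (LINT x|lebesgue_on {0..<2*pi}. (1 / (2*pi)) *\<^sub>R f x)"
    unfolding torus_def by (rule integral_density) (use meas in auto)
  also have "\<dots> = (1 / (2*pi)) *\<^sub>R (LINT x|lebesgue_on {0..<2*pi}. f x)"
    by simp
  also have "(LINT x|lebesgue_on {0..<2*pi}. f x) = integral {0..<2*pi} f"
    using int by (rule lebesgue_integral_eq_integral) simp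
  also have "\<dots> = integral {0..2*pi} f"
  proof (rule integral_spike_set)
    have "{x \<in> {0..<2*pi} - {0..2*pi}. f x \<noteq> 0} = {}" by auto
    then show "negligible {x \<in> {0..<2*pi} - {0..2*pi}. f x \<noteq> 0}"
      by (simp only: negligible_empty)
    show "negligible {x \<in> {0..2*pi} - {0..<2*pi}. f x \<noteq> 0}"
      by (rule negligible_subset[of "{2*pi}"]) auto
  qed
  finally show ?thesis by (simp add: scaleR_conv_of_real)
qed

lemma integral_cis_torus: "(LINT x|torus. cis (of_int n * x)) = (if n = 0 then 1 else 0)"
proof (cases "n = 0")
  case True
  then show ?thesis by (simp add: measure_torus_space)
next
  case False
  have "((\<lambda>x. cis (of_int n * x)) has_integral
      (cis (of_int n * (2*pi)) / (\<i> * of_int n) - cis (of_int n * 0) / (\<i> * of_int n))) {0..2*pi}"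
    using False
    by (intro fundamental_theorem_of_calculus)
       (auto simp: has_vector_derivative_def scaleR_conv_of_real fun_eq_iff field_simps intro!: derivative_eq_intros)
  moreover have "cis (of_int n * (2*pi)) = 1"
    using cis_multiple_2pi[of "of_int n"] by (simp add: mult.commute)
  ultimately have "integral {0..2*pi} (\<lambda>x. cis (of_int n * x)) = 0"
    by (simp add: integral_unique)
  then show ?thesis
    using False by (subst integral_torus) (auto intro!: continuous_intros)
qed

lemma fourier_coeff_expo: "fourier_coeff (expo j) k = (if j = k then 1 else 0)"
proof -
  have "fourier_coeff (expo j) k = (LINT x|torus. cis (of_int (j - k) * x))"
    by transfer (simp add: cis_mult algebra_simps)
  then show ?thesis using integral_cis_torus[of "j - k"] by simp
qed

lemma inner_expo: "inner f (scaleC_L2 c (expo k)) = Re (cnj c * fourier_coeff f k)"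
proof (transfer fixing: c k, goal_cases)
  case (1 f)
  have "(LINT x|torus. f x * cnj (c * cis (of_int k * x)))
      = (LINT x|torus. cnj c * (f x * cis (- (of_int k * x))))"
    by (simp add: cis_cnj algebra_simps)
  then show ?case by simp
qed

lemma fourier_coeff_trig_sum:
  assumes "finite K"
  shows "fourier_coeff (\<Sum>k\<in>K. scaleC_L2 (c k) (expo k)) j = (if j \<in> K then c j else 0)"
  using assms by (simp add: fourier_coeff_sum fourier_coeff_scaleC fourier_coeff_expo if_distrib sum.delta' cong: if_cong)

lemma norm_trig_sum:
  assumes "finite K"
  shows "(norm (\<Sum>k\<in>K. scaleC_L2 (c k) (expo k)))\<^sup>2 = (\<Sum>k\<in>K. (cmod (c k))\<^sup>2)"
proof -
  define p where "p = (\<Sum>k\<in>K. scaleC_L2 (c k) (expo k))"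
  have "(norm p)\<^sup>2 = inner p (\<Sum>k\<in>K. scaleC_L2 (c k) (expo k))"
    by (simp add: power2_norm_eq_inner p_def)
  also have "\<dots> = (\<Sum>k\<in>K. Re (cnj (c k) * c k))"
    using assms by (simp add: inner_sum_right inner_expo p_def fourier_coeff_trig_sum)
  also have "\<dots> = (\<Sum>k\<in>K. (cmod (c k))\<^sup>2)"
    by (intro sum.cong refl) (simp add: cmod_power2, simp add: power2_eq_square)
  finally show ?thesis by (simp add: p_def)
qed

lemma norm_diff_trig_sum:
  assumes "finite K"
  shows "(norm (f - (\<Sum>k\<in>K. scaleC_L2 (c k) (expo k))))\<^sup>2
    = (norm f)\<^sup>2 - (\<Sum>k\<in>K. (cmod (fourier_coeff f k))\<^sup>2) + (\<Sum>k\<in>K. (cmod (fourier_coeff f k - c k))\<^sup>2)"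
proof -
  define p where "p = (\<Sum>k\<in>K. scaleC_L2 (c k) (expo k))"
  have "(norm (f - p))\<^sup>2 = (norm f)\<^sup>2 - 2 * inner f p + (norm p)\<^sup>2"
    by (simp add: power2_norm_eq_inner inner_diff_left inner_diff_right inner_commute)
  also have "inner f p = (\<Sum>k\<in>K. Re (cnj (c k) * fourier_coeff f k))"
    by (simp add: p_def inner_sum_right inner_expo)
  also have "(norm p)\<^sup>2 = (\<Sum>k\<in>K. (cmod (c k))\<^sup>2)"
    unfolding p_def by (rule norm_trig_sum[OF assms])
  also have "(norm f)\<^sup>2 - 2 * (\<Sum>k\<in>K. Re (cnj (c k) * fourier_coeff f k)) + (\<Sum>k\<in>K. (cmod (c k))\<^sup>2)
    = (norm f)\<^sup>2 + (\<Sum>k\<in>K. (cmod (c k))\<^sup>2 - 2 * Re (cnj (c k) * fourier_coeff f k))"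
    by (simp add: sum_subtractf sum_distrib_left)
  also have "(\<Sum>k\<in>K. (cmod (c k))\<^sup>2 - 2 * Re (cnj (c k) * fourier_coeff f k))
    = (\<Sum>k\<in>K. (cmod (fourier_coeff f k - c k))\<^sup>2 - (cmod (fourier_coeff f k))\<^sup>2)"
    by (intro sum.cong refl) (simp add: cmod_power2, simp add: power2_eq_square algebra_simps)
  finally show ?thesis by (simp add: p_def sum_subtractf)
qed

lemma Bessel:
  assumes "finite K"
  shows "(\<Sum>k\<in>K. (cmod (fourier_coeff f k))\<^sup>2) \<le> (norm f)\<^sup>2"
  using norm_diff_trig_sum[OF assms, of f "fourier_coeff f"]
    zero_le_power2[of "norm (f - (\<Sum>k\<in>K. scaleC_L2 (fourier_coeff f k) (expo k)))"] by simp

lemma norm_fourier_coeff_le: "cmod (fourier_coeff f k) \<le> norm f"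
  by (rule power2_le_imp_le) (use Bessel[of "{k}" f] in auto)

section \<open>Completeness of the exponentials\<close>

lemma AE_torus_I:
  assumes "negligible N" "\<And>x. 0 \<le> x \<Longrightarrow> x < 2*pi \<Longrightarrow> x \<notin> N \<Longrightarrow> P x"
  shows "AE x in torus. P x"
proof -
  have "AE x in lebesgue. x \<notin> N"
    using assms(1) by (intro AE_not_in) (simp add: negligible_iff_null_sets)
  then have "AE x in lebesgue_on {0..<2*pi}. P x"
    by (subst AE_restrict_space_iff) (use assms(2) in auto)
  then show ?thesis
    unfolding torus_def by (subst AE_density) auto
qed

lemma sq_integrable_bounded:
  assumes "f \<in> borel_measurable torus" "\<And>x. x \<in> space torus \<Longrightarrow> cmod (f x) \<le> B"
  shows "sq_integrable f"
  unfolding sq_integrable_def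
proof (intro conjI)
  have "AE x in torus. norm ((cmod (f x))\<^sup>2) \<le> B\<^sup>2"
    using assms(2) by (intro AE_I2) (auto intro: power_mono)
  moreover have "(\<lambda>x. (cmod (f x))\<^sup>2) \<in> borel_measurable torus"
    using assms(1) by measurable
  ultimately show "integrable torus (\<lambda>x. (cmod (f x))\<^sup>2)"
    by (intro torus.integrable_const_bound)
qed (rule assms(1))

lemma norm_diff_abs_L2_le:
  assumes "sq_integrable f" "sq_integrable g" "0 \<le> e"
    "\<And>x. x \<in> space torus \<Longrightarrow> cmod (f x - g x) \<le> e"
  shows "norm (abs_L2 f - abs_L2 g) \<le> e"
proof -
  have sq: "sq_integrable (\<lambda>x. f x - g x)"
    using assms by (intro sq_integrable_diff)
  have "(LINT x|torus. (cmod (f x - g x))\<^sup>2) \<le> (LINT x|torus. e\<^sup>2)"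
    using sq assms(4) by (intro integral_mono) (auto simp: sq_integrable_def intro: power_mono)
  also have "\<dots> = e\<^sup>2"
    by (simp add: measure_torus_space)
  finally show ?thesis
    using assms sq by (simp add: diff_abs_L2 norm_abs_L2 real_le_lsqrt)
qed

lemma abs_L2_dominated_convergence:
  assumes f: "sq_integrable f" and u: "\<And>n. sq_integrable (u n)"
    and lim: "AE x in torus. (\<lambda>n. u n x) \<longlonglongrightarrow> f x"
    and dom: "\<And>n x. x \<in> space torus \<Longrightarrow> cmod (u n x) \<le> w x"
      "\<And>x. x \<in> space torus \<Longrightarrow> cmod (f x) \<le> w x"
    and w: "integrable torus (\<lambda>x. (w x)\<^sup>2)"
  shows "(\<lambda>n. abs_L2 (u n)) \<longlonglongrightarrow> abs_L2 f"
proof -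
  have sq: "sq_integrable (\<lambda>x. u n x - f x)" for n
    using f u by (intro sq_integrable_diff)
  have "(\<lambda>n. LINT x|torus. (cmod (u n x - f x))\<^sup>2) \<longlonglongrightarrow> (LINT x|torus. 0)"
  proof (rule integral_dominated_convergence)
    show "integrable torus (\<lambda>x. 4 * (w x)\<^sup>2)"
      using w by simp
    show "AE x in torus. (\<lambda>n. (cmod (u n x - f x))\<^sup>2) \<longlonglongrightarrow> 0"
      using lim
    proof eventually_elim
      case (elim x)
      then have "(\<lambda>n. (cmod (u n x - f x))\<^sup>2) \<longlonglongrightarrow> (cmod (f x - f x))\<^sup>2"
        by (intro tendsto_power tendsto_norm tendsto_diff tendsto_const)
      then show ?case by simp
    qed
    show "AE x in torus. norm ((cmod (u n x - f x))\<^sup>2) \<le> 4 * (w x)\<^sup>2" for n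
    proof (rule AE_I2)
      fix x assume "x \<in> space torus"
      then have "cmod (u n x - f x) \<le> 2 * w x"
        using dom(1)[of x n] dom(2)[of x] norm_triangle_ineq4[of "u n x" "f x"] by linarith
      then have "(cmod (u n x - f x))\<^sup>2 \<le> (2 * w x)\<^sup>2"
        by (intro power_mono) auto
      then show "norm ((cmod (u n x - f x))\<^sup>2) \<le> 4 * (w x)\<^sup>2"
        by (simp add: power_mult_distrib)
    qed
  qed (use sq in \<open>auto simp: sq_integrable_def\<close>)
  then have "(\<lambda>n. sqrt (LINT x|torus. (cmod (u n x - f x))\<^sup>2)) \<longlonglongrightarrow> sqrt 0"
    by (intro tendsto_real_sqrt) simp
  then have "(\<lambda>n. norm (abs_L2 (u n) - abs_L2 f)) \<longlonglongrightarrow> 0"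
    using f u sq by (simp add: diff_abs_L2 norm_abs_L2)
  then show ?thesis
    by (simp add: LIM_zero_iff tendsto_norm_zero_iff)
qed

inductive trig_poly :: "(real \<Rightarrow> complex) \<Rightarrow> bool" where
  base: "trig_poly (\<lambda>x. c * cis (of_int k * x))"
| add: "trig_poly f \<Longrightarrow> trig_poly g \<Longrightarrow> trig_poly (\<lambda>x. f x + g x)"

lemma trig_poly_const: "trig_poly (\<lambda>x. c)"
  using trig_poly.base[of c 0] by simp

lemma trig_poly_mult:
  assumes "trig_poly f" "trig_poly g"
  shows "trig_poly (\<lambda>x. f x * g x)"
  using assms
proof (induction arbitrary: g)
  case (base c k)
  from base show ?case
  proof induction
    case (base d j)
    show ?case
    proof -
      have "(\<lambda>x. c * cis (of_int k * x) * (d * cis (of_int j * x)))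
          = (\<lambda>x. c * d * cis (of_int (k + j) * x))"
        by (simp add: algebra_simps flip: cis_mult)
      then show ?thesis by (simp only: trig_poly.base)
    qed
  next
    case (add f g)
    show ?case
      unfolding distrib_left by (intro trig_poly.add add.IH)
  qed
next
  case (add f1 f2)
  show ?case
    unfolding distrib_right by (intro trig_poly.add add.IH add.prems)
qed

lemma trig_poly_cos: "trig_poly (\<lambda>x. of_real (cos x))"
  and trig_poly_sin: "trig_poly (\<lambda>x. of_real (sin x))"
proof -
  have "trig_poly (\<lambda>x. (1/2) * cis (of_int 1 * x) + (1/2) * cis (of_int (-1) * x))"
    by (intro trig_poly.intros)
  moreover have "(1/2) * cis (of_int 1 * x) + (1/2) * cis (of_int (-1) * x) = of_real (cos x)" for x
    by (simp add: complex_eq_iff)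
  ultimately show "trig_poly (\<lambda>x. of_real (cos x))" by simp
  have "trig_poly (\<lambda>x. (-\<i>/2) * cis (of_int 1 * x) + (\<i>/2) * cis (of_int (-1) * x))"
    by (intro trig_poly.intros)
  moreover have "(-\<i>/2) * cis (of_int 1 * x) + (\<i>/2) * cis (of_int (-1) * x) = of_real (sin x)" for x
    by (simp add: complex_eq_iff)
  ultimately show "trig_poly (\<lambda>x. of_real (sin x))" by simp
qed

lemma trig_poly_real_polynomial_function:
  fixes p :: "complex \<Rightarrow> real"
  assumes "real_polynomial_function p"
  shows "trig_poly (\<lambda>x. of_real (p (cis x)))"
  using assms
proof induction
  case (linear f)
  then interpret bounded_linear f .
  have "f (cis x) = cos x * f 1 + sin x * f \<i>" for x
  proof -
    have "cis x = cos x *\<^sub>R 1 + sin x *\<^sub>R \<i>"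
      by (simp add: complex_eq_iff)
    then show ?thesis by (simp only: add scaleR) simp
  qed
  then have "(\<lambda>x. of_real (f (cis x))) = (\<lambda>x. complex_of_real (cos x) * of_real (f 1) + of_real (sin x) * of_real (f \<i>))"
    by auto
  then show ?case
    by (simp only:) (intro trig_poly.add trig_poly_mult trig_poly_cos trig_poly_sin trig_poly_const)
next
  case (const c)
  then show ?case by (rule trig_poly_const)
next
  case (add f g)
  show ?case
    unfolding of_real_add by (intro trig_poly.add add.IH)
next
  case (mult f g)
  show ?case
    unfolding of_real_mult by (intro trig_poly_mult mult.IH)
qed

lemma trig_poly_polynomial_function:
  fixes p :: "complex \<Rightarrow> complex"
  assumes "polynomial_function p"
  shows "trig_poly (\<lambda>x. p (cis x))"
proof -
  have "trig_poly (\<lambda>x. of_real ((Re \<circ> p) (cis x)) + \<i> * of_real ((Im \<circ> p) (cis x)))"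
    using assms bounded_linear_Re bounded_linear_Im unfolding polynomial_function_def
    by (intro trig_poly.add trig_poly_mult trig_poly_const trig_poly_real_polynomial_function)
      (auto simp: comp_def)
  then show ?thesis
    by (simp flip: complex_eq)
qed

text \<open>The periodic function descends to the circle because \<^const>\<open>cis\<close> is a closed map
  on the compact interval; the Weierstrass theorem then applies on the circle.\<close>

lemma trig_poly_uniform_approx:
  fixes v :: "real \<Rightarrow> complex"
  assumes v: "continuous_on {0..2*pi} v" and per: "v 0 = v (2*pi)" and e: "0 < e"
  obtains p where "trig_poly p" "\<And>x. x \<in> {0..2*pi} \<Longrightarrow> cmod (v x - p x) < e"
proof -
  define S where "S = sphere (0::complex) 1"
  define w where "w z = v (Arg2pi z)" for z
  have w_cis: "w (cis x) = v x" if "x \<in> {0..2*pi}" for x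
  proof (cases "x = 2*pi")
    case True
    then show ?thesis using per Arg2pi_of_real[of 1] by (simp add: w_def)
  next
    case False
    then show ?thesis
      using that Arg2pi_unique[of 1 x "cis x"] by (simp add: w_def cis_conv_exp mult.commute)
  qed
  have in_circle: "\<exists>x\<in>{0..2*pi}. z = cis x" if "z \<in> S" for z
  proof -
    have "z = cis (Arg2pi z)"
      using that Arg2pi_eq[of z] by (simp add: S_def cis_conv_exp mult.commute)
    then show ?thesis
      using Arg2pi_ge_0[of z] Arg2pi_lt_2pi[of z] by (metis atLeastAtMost_iff less_eq_real_def)
  qed
  have "continuous_on S w"
  proof (subst continuous_on_closed_vimage, goal_cases)
    case 1
    show ?case by (simp add: S_def)
  next
    case 2
    show ?case
    proof (intro allI impI)
      fix C :: "complex set" assume C: "closed C"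
      have "w -` C \<inter> S = cis ` (v -` C \<inter> {0..2*pi})"
      proof (intro equalityI subsetI)
        fix z assume z: "z \<in> w -` C \<inter> S"
        then obtain x where "x \<in> {0..2*pi}" "z = cis x"
          using in_circle by blast
        then show "z \<in> cis ` (v -` C \<inter> {0..2*pi})"
          using z w_cis[of x] by auto
      next
        fix z assume "z \<in> cis ` (v -` C \<inter> {0..2*pi})"
        then obtain x where "x \<in> {0..2*pi}" "z = cis x" "v x \<in> C"
          by blast
        then show "z \<in> w -` C \<inter> S"
          using w_cis[of x] by (simp add: S_def)
      qed
      moreover have "compact ({0..2*pi} \<inter> v -` C)"
        using continuous_closed_preimage[OF v _ C] bounded_subset[OF bounded_closed_interval Int_lower1]
        by (simp add: compact_eq_bounded_closed)
      then have "compact (cis ` (v -` C \<inter> {0..2*pi}))"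
        by (intro compact_continuous_image continuous_intros) (simp add: Int_commute)
      ultimately show "closed (w -` C \<inter> S)"
        by (simp add: compact_imp_closed)
    qed
  qed
  moreover have "compact S" by (simp add: S_def)
  ultimately obtain q where q: "polynomial_function q" "\<And>z. z \<in> S \<Longrightarrow> cmod (w z - q z) < e"
    using Stone_Weierstrass_polynomial_function[OF _ _ e, of S w] by blast
  show thesis
  proof (rule that)
    show "trig_poly (\<lambda>x. q (cis x))"
      using q(1) by (rule trig_poly_polynomial_function)
    show "cmod (v x - q (cis x)) < e" if "x \<in> {0..2*pi}" for x
      using q(2)[of "cis x"] w_cis[OF that] by (simp add: S_def)
  qed
qed

lemma trig_poly_L2:
  assumes "trig_poly p"
  shows "sq_integrable p \<and> (\<exists>K c. finite K \<and> abs_L2 p = (\<Sum>k\<in>K. scaleC_L2 (c k) (expo k)))"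
  using assms
proof induction
  case (base c k)
  have "abs_L2 (\<lambda>x. c * cis (of_int k * x)) = scaleC_L2 c (expo k)"
    by (simp add: expo_eq scaleC_L2.abs_eq sq_integrable_cis)
  then have "abs_L2 (\<lambda>x. c * cis (of_int k * x)) = (\<Sum>j\<in>{k}. scaleC_L2 c (expo j))"
    by simp
  moreover have "sq_integrable (\<lambda>x. c * cis (of_int k * x))"
    by (intro sq_integrable_cmult sq_integrable_cis)
  ultimately show ?case
    by (intro conjI exI[of _ "{k}"] exI[of _ "\<lambda>_. c"]) auto
next
  case (add f g)
  then obtain K c L d where K: "finite K" "abs_L2 f = (\<Sum>k\<in>K. scaleC_L2 (c k) (expo k))"
    and L: "finite L" "abs_L2 g = (\<Sum>k\<in>L. scaleC_L2 (d k) (expo k))" by blast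
  define c' where "c' k = (if k \<in> K then c k else 0)" for k
  define d' where "d' k = (if k \<in> L then d k else 0)" for k
  have "abs_L2 (\<lambda>x. f x + g x) = abs_L2 f + abs_L2 g"
    using add by (simp add: plus_L2.abs_eq)
  also have "abs_L2 f = (\<Sum>k\<in>K \<union> L. scaleC_L2 (c' k) (expo k))"
    unfolding K(2) by (rule sum.mono_neutral_cong_left) (use K(1) L(1) in \<open>auto simp: c'_def\<close>)
  also have "abs_L2 g = (\<Sum>k\<in>K \<union> L. scaleC_L2 (d' k) (expo k))"
    unfolding L(2) by (rule sum.mono_neutral_cong_left) (use K(1) L(1) in \<open>auto simp: d'_def\<close>)
  finally have "abs_L2 (\<lambda>x. f x + g x) = (\<Sum>k\<in>K \<union> L. scaleC_L2 (c' k + d' k) (expo k))"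
    by (simp add: scaleC_add_left sum.distrib)
  moreover have "sq_integrable (\<lambda>x. f x + g x)"
    using add by (intro sq_integrable_add) auto
  moreover have "finite (K \<union> L)"
    using K(1) L(1) by simp
  ultimately show ?case
    by (intro conjI exI[of _ "K \<union> L"] exI[of _ "\<lambda>k. c' k + d' k"])
qed

lemma trig_poly_dense: "F \<in> closure {abs_L2 p | p. trig_poly p}"
proof -
  let ?T = "closure {abs_L2 p | p. trig_poly p}"
  have periodic: "abs_L2 v \<in> ?T"
    if v: "continuous_on UNIV v" "v 0 = v (2*pi)" "sq_integrable v" for v
  proof -
    have "\<exists>y\<in>{abs_L2 p | p. trig_poly p}. dist y (abs_L2 v) < e" if "0 < e" for e
    proof -
      obtain p where p: "trig_poly p" "\<And>x. x \<in> {0..2*pi} \<Longrightarrow> cmod (v x - p x) < e / 2"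
        using trig_poly_uniform_approx[of v "e / 2"] v(1,2) \<open>0 < e\<close> continuous_on_subset
        by (metis half_gt_zero top_greatest)
      have "norm (abs_L2 v - abs_L2 p) \<le> e / 2"
        using v(3) trig_poly_L2[OF p(1)] p(2) \<open>0 < e\<close>
        by (intro norm_diff_abs_L2_le) (auto simp: space_torus intro: less_imp_le)
      then have "dist (abs_L2 p) (abs_L2 v) < e"
        using \<open>0 < e\<close> by (simp add: dist_norm norm_minus_commute)
      then show ?thesis using p(1) by blast
    qed
    then show ?thesis unfolding closure_approachable by blast
  qed
  have bounded: "abs_L2 f \<in> ?T"
    if f: "sq_integrable f" "\<And>x. x \<in> space torus \<Longrightarrow> cmod (f x) \<le> B" "0 < B" for f B
  proof -
    have "f \<in> borel_measurable (lebesgue_on {0..<2*pi})"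
      using f(1) by (simp add: sq_integrable_def torus_def)
    then have "f measurable_on {0..<2*pi}"
      by (simp add: measurable_on_iff_borel_measurable)
    then obtain N g where N: "negligible N" and g: "\<And>n. continuous_on UNIV (g n)"
      and lim: "\<And>x. x \<notin> N \<Longrightarrow> (\<lambda>n. g n x) \<longlonglongrightarrow> (if x \<in> {0..<2*pi} then f x else 0)"
      unfolding measurable_on_def by blast
    define ch :: "nat \<Rightarrow> real \<Rightarrow> real" where "ch n x = min 1 (real n * (x * (2*pi - x)))" for n x
    define cl where "cl z = z * of_real (B / max B (cmod z))" for z :: complex
    define u where "u n x = of_real (ch n x) * cl (g n x)" for n x
    have cl_cont: "continuous_on UNIV cl"
      unfolding cl_def using f(3) by (intro continuous_intros) auto
    have cl_le: "cmod (cl z) \<le> B" for z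
      using f(3) by (cases "cmod z \<le> B") (auto simp: cl_def norm_mult norm_divide max_def)
    have cl_id: "cl z = z" if "cmod z \<le> B" for z
      using that f(3) by (simp add: cl_def max_absorb1)
    have u_cont: "continuous_on UNIV (u n)" for n
      unfolding u_def ch_def
      by (intro continuous_intros continuous_on_compose2[OF cl_cont g]) auto
    have u_le: "cmod (u n x) \<le> B" if "x \<in> space torus" for n x
    proof -
      have "0 \<le> ch n x" "ch n x \<le> 1"
        using that by (auto simp: ch_def space_torus)
      then have "cmod (u n x) \<le> 1 * B"
        unfolding u_def norm_mult by (intro mult_mono cl_le) auto
      then show ?thesis by simp
    qed
    have u_sq: "sq_integrable (u n)" for n
      using u_le measurable_torus_continuous[OF u_cont] by (rule sq_integrable_bounded[rotated])
    have "AE x in torus. (\<lambda>n. u n x) \<longlonglongrightarrow> f x"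
    proof (rule AE_torus_I)
      show "negligible (insert 0 N)"
        using N by simp
      fix x assume x: "0 \<le> x" "x < 2*pi" "x \<notin> insert 0 N"
      then have pos: "0 < x * (2*pi - x)" by simp
      have "\<forall>\<^sub>F n in sequentially. 1 / (x * (2*pi - x)) \<le> real n"
        using eventually_ge_at_top[of "nat \<lceil>1 / (x * (2*pi - x))\<rceil>"]
        by eventually_elim linarith
      then have "\<forall>\<^sub>F n in sequentially. cl (g n x) = u n x"
        by eventually_elim (use pos in \<open>simp add: u_def ch_def field_simps min_absorb1\<close>)
      moreover have "(\<lambda>n. cl (g n x)) \<longlonglongrightarrow> cl (f x)"
        using lim[of x] x cl_cont
        by (intro isCont_tendsto_compose[of _ cl]) (auto simp: continuous_on_eq_continuous_at)
      ultimately have "(\<lambda>n. u n x) \<longlonglongrightarrow> cl (f x)"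
        by (rule Lim_transform_eventually[rotated])
      then show "(\<lambda>n. u n x) \<longlonglongrightarrow> f x"
        using cl_id[OF f(2)] x by (simp add: space_torus)
    qed
    then have "(\<lambda>n. abs_L2 (u n)) \<longlonglongrightarrow> abs_L2 f"
      using f u_sq u_le by (intro abs_L2_dominated_convergence[where w="\<lambda>_. B"]) auto
    moreover have "abs_L2 (u n) \<in> ?T" for n
      using u_cont u_sq by (intro periodic) (auto simp: u_def ch_def)
    ultimately show ?thesis
      by (rule closed_sequentially[OF closed_closure, rotated])
  qed
  obtain f where f: "sq_integrable f" "F = abs_L2 f"
    by (rule L2_cases)
  define t where "t n x = (if cmod (f x) \<le> real n then f x else 0)" for n x
  have t_sq: "sq_integrable (t n)" for n
  proof (rule sq_integrable_bounded)
    have "f \<in> borel_measurable torus"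
      using f(1) by (simp add: sq_integrable_def)
    then show "t n \<in> borel_measurable torus"
      unfolding t_def by measurable
    show "cmod (t n x) \<le> real n" for x
      by (simp add: t_def)
  qed
  have "(\<lambda>n. abs_L2 (t n)) \<longlonglongrightarrow> abs_L2 f"
  proof (rule abs_L2_dominated_convergence[where w="\<lambda>x. cmod (f x)"])
    show "AE x in torus. (\<lambda>n. t n x) \<longlonglongrightarrow> f x"
    proof (rule AE_I2, rule tendsto_eventually)
      fix x
      show "\<forall>\<^sub>F n in sequentially. t n x = f x"
        using eventually_ge_at_top[of "nat \<lceil>cmod (f x)\<rceil>"]
      proof eventually_elim
        case (elim n)
        then have "cmod (f x) \<le> real n" by linarith
        then show ?case by (simp add: t_def)
      qed
    qed
  qed (use f(1) t_sq in \<open>auto simp: t_def sq_integrable_def\<close>)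
  moreover have "abs_L2 (t n) \<in> ?T" for n
    by (rule bounded[OF t_sq, of _ "real n + 1"]) (auto simp: t_def)
  ultimately show ?thesis
    unfolding f(2) by (rule closed_sequentially[OF closed_closure, rotated])
qed

lemma trig_approx:
  assumes "0 < e"
  obtains K c where "finite K" "norm (F - (\<Sum>k\<in>K. scaleC_L2 (c k) (expo k))) < e"
proof -
  obtain p where p: "trig_poly p" "dist (abs_L2 p) F < e"
    using trig_poly_dense[of F] assms unfolding closure_approachable by blast
  then show thesis
    using that trig_poly_L2[OF p(1)] by (metis dist_norm norm_minus_commute)
qed

theorem Fourier_expansion: "((\<lambda>k. scaleC_L2 (fourier_coeff F k) (expo k)) has_sum F) UNIV"
  unfolding has_sum_def
proof (rule tendstoI)
  fix e :: real assume "0 < e"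
  then obtain K c where K: "finite K" and lt: "norm (F - (\<Sum>k\<in>K. scaleC_L2 (c k) (expo k))) < e"
    by (rule trig_approx)
  have "dist (\<Sum>k\<in>L. scaleC_L2 (fourier_coeff F k) (expo k)) F < e" if L: "finite L" "K \<subseteq> L" for L
  proof -
    have "(norm (F - (\<Sum>k\<in>L. scaleC_L2 (fourier_coeff F k) (expo k))))\<^sup>2
        = (norm F)\<^sup>2 - (\<Sum>k\<in>L. (cmod (fourier_coeff F k))\<^sup>2)"
      using norm_diff_trig_sum[OF L(1), of F "fourier_coeff F"] by simp
    also have "\<dots> \<le> (norm F)\<^sup>2 - (\<Sum>k\<in>K. (cmod (fourier_coeff F k))\<^sup>2)"
      using L by (simp add: sum_mono2)
    also have "\<dots> \<le> (norm (F - (\<Sum>k\<in>K. scaleC_L2 (c k) (expo k))))\<^sup>2"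
      unfolding norm_diff_trig_sum[OF K] by (simp add: sum_nonneg)
    finally have "norm (F - (\<Sum>k\<in>L. scaleC_L2 (fourier_coeff F k) (expo k)))
        \<le> norm (F - (\<Sum>k\<in>K. scaleC_L2 (c k) (expo k)))"
      by (rule power2_le_imp_le) simp
    then show ?thesis
      using lt by (simp add: dist_norm norm_minus_commute)
  qed
  then show "\<forall>\<^sub>F L in finite_subsets_at_top UNIV.
      dist (\<Sum>k\<in>L. scaleC_L2 (fourier_coeff F k) (expo k)) F < e"
    using K by (auto simp: eventually_finite_subsets_at_top)
qed

theorem Parseval: "((\<lambda>k. (cmod (fourier_coeff F k))\<^sup>2) has_sum (norm F)\<^sup>2) UNIV"
proof -
  have "((\<lambda>K. norm (\<Sum>k\<in>K. scaleC_L2 (fourier_coeff F k) (expo k))^2) \<longlongrightarrow> norm F ^ 2)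
      (finite_subsets_at_top UNIV)"
    using Fourier_expansion[of F] unfolding has_sum_def by (intro tendsto_power tendsto_norm)
  moreover have "\<forall>\<^sub>F K in finite_subsets_at_top UNIV.
      (norm (\<Sum>k\<in>K. scaleC_L2 (fourier_coeff F k) (expo k)))\<^sup>2 = (\<Sum>k\<in>K. (cmod (fourier_coeff F k))\<^sup>2)"
    by (auto simp: eventually_finite_subsets_at_top norm_trig_sum)
  ultimately show ?thesis
    unfolding has_sum_def by (rule Lim_transform_eventually)
qed

lemma L2_eqI:
  assumes "\<And>k. fourier_coeff F k = fourier_coeff G k"
  shows "F = G"
  using has_sum_unique[OF Fourier_expansion[of F]] Fourier_expansion[of G] assms by simp

section \<open>The Riesz--Fischer theorem and convolution operators\<close>

lemma L2_fast_Cauchy_convergent: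
  fixes X :: "nat \<Rightarrow> L2"
  assumes fast: "\<And>n. norm (X (Suc n) - X n) \<le> (1/2) ^ n"
  shows "convergent X"
proof -
  have "\<exists>f. sq_integrable f \<and> X n = abs_L2 f" for n
    by (rule L2_cases[of "X n"]) auto
  then obtain f where f: "\<And>n. sq_integrable (f n)" and X: "\<And>n. X n = abs_L2 (f n)"
    by metis
  have meas [measurable]: "f n \<in> borel_measurable torus" for n
    using f[of n] by (simp add: sq_integrable_def)
  have sq: "sq_integrable (\<lambda>x. f m x - f n x)" for m n
    using f by (intro sq_integrable_diff)
  have norm_X: "(norm (X m - X n))\<^sup>2 = (LINT x|torus. (cmod (f m x - f n x))\<^sup>2)" for m n
    using f sq by (simp add: X diff_abs_L2 norm_abs_L2)
  have tail: "norm (X (n + k) - X n) \<le> 2 * (1/2) ^ n - 2 * (1/2) ^ (n + k)" for n k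
  proof (induction k)
    case (Suc k)
    have "norm (X (n + Suc k) - X n) \<le> norm (X (Suc (n + k)) - X (n + k)) + norm (X (n + k) - X n)"
      using norm_triangle_ineq[of "X (Suc (n + k)) - X (n + k)" "X (n + k) - X n"] by simp
    also have "\<dots> \<le> (1/2) ^ (n + k) + (2 * (1/2) ^ n - 2 * (1/2) ^ (n + k))"
      by (intro add_mono fast Suc)
    finally show ?case by simp
  qed simp
  have tail': "norm (X m - X n) \<le> 2 * (1/2) ^ n" if "n \<le> m" for m n
  proof -
    have "norm (X m - X n) \<le> 2 * (1/2) ^ n - 2 * (1/2) ^ m"
      using tail[of n "m - n"] that by simp
    moreover have "0 \<le> (1/2 :: real) ^ m" by simp
    ultimately show ?thesis by linarith
  qed
  have L1: "(\<integral>\<^sup>+x. ennreal (cmod (f (Suc n) x - f n x)) \<partial>torus) \<le> ennreal ((1/2) ^ n)" for n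
  proof -
    define t where "t = (1/2 :: real) ^ n"
    have t: "0 < t" by (simp add: t_def)
    have int: "integrable torus (\<lambda>x. (cmod (f (Suc n) x - f n x))\<^sup>2 / t + t)"
      using sq[of "Suc n" n] by (simp add: sq_integrable_def)
    have AMGM: "y * 2 \<le> y\<^sup>2 / t + t" for y :: real
    proof -
      have "0 \<le> (y - t)\<^sup>2 / t"
        using t by simp
      also have "(y - t)\<^sup>2 / t = y\<^sup>2 / t + t - 2 * y"
        using t by (simp add: field_simps power2_eq_square)
      finally show ?thesis by simp
    qed
    have "(\<integral>\<^sup>+x. ennreal (cmod (f (Suc n) x - f n x)) \<partial>torus)
        \<le> (\<integral>\<^sup>+x. ennreal (((cmod (f (Suc n) x - f n x))\<^sup>2 / t + t) / 2) \<partial>torus)"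
      using AMGM by (intro nn_integral_mono ennreal_leI) simp
    also have "\<dots> = ennreal (LINT x|torus. ((cmod (f (Suc n) x - f n x))\<^sup>2 / t + t) / 2)"
      using int t by (intro nn_integral_eq_integral) auto
    also have "(LINT x|torus. ((cmod (f (Suc n) x - f n x))\<^sup>2 / t + t) / 2)
        = ((norm (X (Suc n) - X n))\<^sup>2 / t + t) / 2"
      using sq[of "Suc n" n] by (simp add: norm_X measure_torus_space sq_integrable_def)
    also have "\<dots> \<le> (t\<^sup>2 / t + t) / 2"
      using fast[of n] t by (intro divide_right_mono add_mono power_mono) (auto simp: t_def)
    also have "\<dots> = t"
      using t by (simp add: power2_eq_square)
    finally show ?thesis
      by (simp add: t_def ennreal_leI)
  qed
  have "(\<integral>\<^sup>+x. (\<Sum>n. ennreal (cmod (f (Suc n) x - f n x))) \<partial>torus)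
      = (\<Sum>n. \<integral>\<^sup>+x. ennreal (cmod (f (Suc n) x - f n x)) \<partial>torus)"
    by (intro nn_integral_suminf) measurable
  also have "\<dots> \<le> (\<Sum>n. ennreal ((1/2) ^ n))"
    by (intro suminf_le L1) auto
  also have "\<dots> = ennreal (\<Sum>n. (1/2) ^ n)"
    by (intro suminf_ennreal2) (auto simp: summable_geometric)
  finally have "(\<integral>\<^sup>+x. (\<Sum>n. ennreal (cmod (f (Suc n) x - f n x))) \<partial>torus) \<noteq> \<infinity>"
    by (auto simp: top_unique)
  then have "AE x in torus. (\<Sum>n. ennreal (cmod (f (Suc n) x - f n x))) \<noteq> \<infinity>"
    by (intro nn_integral_PInf_AE) measurable
  then have conv: "AE x in torus. (\<lambda>n. f n x) \<longlonglongrightarrow> lim (\<lambda>n. f n x)"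
  proof eventually_elim
    case (elim x)
    then have "summable (\<lambda>n. cmod (f (Suc n) x - f n x))"
      by (intro summable_suminf_not_top) auto
    then have "summable (\<lambda>n. f (Suc n) x - f n x)"
      by (rule summable_norm_cancel)
    then have "convergent (\<lambda>n. \<Sum>i<n. f (Suc i) x - f i x)"
      by (simp add: summable_iff_convergent)
    then have "convergent (\<lambda>n. f n x - f 0 x)"
      using sum_lessThan_telescope[of "\<lambda>n. f n x"] by simp
    then have "convergent (\<lambda>n. (f n x - f 0 x) + f 0 x)"
      by (intro convergent_add convergent_const)
    then show ?case
      by (simp add: convergent_LIMSEQ_iff)
  qed
  define h where "h x = lim (\<lambda>n. f n x)" for x
  have h_meas [measurable]: "h \<in> borel_measurable torus"
    unfolding h_def by (intro borel_measurable_lim_metric meas)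
  have Fatou: "(\<integral>\<^sup>+x. ennreal ((cmod (h x - f n x))\<^sup>2) \<partial>torus) \<le> ennreal ((2 * (1/2) ^ n)\<^sup>2)" for n
  proof -
    have "(\<integral>\<^sup>+x. ennreal ((cmod (h x - f n x))\<^sup>2) \<partial>torus)
        = (\<integral>\<^sup>+x. liminf (\<lambda>m. ennreal ((cmod (f m x - f n x))\<^sup>2)) \<partial>torus)"
    proof (rule nn_integral_cong_AE)
      show "AE x in torus. ennreal ((cmod (h x - f n x))\<^sup>2) = liminf (\<lambda>m. ennreal ((cmod (f m x - f n x))\<^sup>2))"
        using conv
      proof eventually_elim
        case (elim x)
        then have "(\<lambda>m. ennreal ((cmod (f m x - f n x))\<^sup>2)) \<longlonglongrightarrow> ennreal ((cmod (h x - f n x))\<^sup>2)"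
          unfolding h_def by (intro tendsto_ennrealI tendsto_power tendsto_norm tendsto_diff tendsto_const)
        then show ?case
          by (intro lim_imp_Liminf[symmetric]) auto
      qed
    qed
    also have "\<dots> \<le> liminf (\<lambda>m. \<integral>\<^sup>+x. ennreal ((cmod (f m x - f n x))\<^sup>2) \<partial>torus)"
      by (intro nn_integral_liminf) measurable
    also have "\<dots> \<le> limsup (\<lambda>m. \<integral>\<^sup>+x. ennreal ((cmod (f m x - f n x))\<^sup>2) \<partial>torus)"
      by (intro Liminf_le_Limsup) auto
    also have "\<dots> \<le> ennreal ((2 * (1/2) ^ n)\<^sup>2)"
    proof (rule Limsup_bounded)
      show "\<forall>\<^sub>F m in sequentially.
          (\<integral>\<^sup>+x. ennreal ((cmod (f m x - f n x))\<^sup>2) \<partial>torus) \<le> ennreal ((2 * (1/2) ^ n)\<^sup>2)"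
        using eventually_ge_at_top[of n]
      proof eventually_elim
        case (elim m)
        have "(\<integral>\<^sup>+x. ennreal ((cmod (f m x - f n x))\<^sup>2) \<partial>torus) = ennreal ((norm (X m - X n))\<^sup>2)"
          unfolding norm_X using sq[of m n]
          by (intro nn_integral_eq_integral) (auto simp: sq_integrable_def)
        also have "\<dots> \<le> ennreal ((2 * (1/2) ^ n)\<^sup>2)"
          by (intro ennreal_leI power_mono tail'[OF elim] norm_ge_zero)
        finally show ?case .
      qed
    qed
    finally show ?thesis .
  qed
  have sq_diff: "sq_integrable (\<lambda>x. h x - f n x)" for n
    unfolding sq_integrable_def
  proof (intro conjI integrableI_nonneg)
    show "(\<integral>\<^sup>+x. ennreal ((cmod (h x - f n x))\<^sup>2) \<partial>torus) < \<infinity>"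
      using Fatou[of n] by (rule le_less_trans) simp
  qed (auto intro: AE_I2)
  have "sq_integrable (\<lambda>x. (h x - f 0 x) + f 0 x)"
    using sq_diff f by (rule sq_integrable_add)
  then have h: "sq_integrable h" by simp
  have bound: "norm (X n - abs_L2 h) \<le> 2 * (1/2) ^ n" for n
  proof -
    have "ennreal ((norm (abs_L2 h - X n))\<^sup>2) = ennreal (LINT x|torus. (cmod (h x - f n x))\<^sup>2)"
      using h f sq_diff by (simp add: X diff_abs_L2 norm_abs_L2)
    also have "\<dots> = (\<integral>\<^sup>+x. ennreal ((cmod (h x - f n x))\<^sup>2) \<partial>torus)"
      using sq_diff[of n] by (intro nn_integral_eq_integral[symmetric]) (auto simp: sq_integrable_def)
    also have "\<dots> \<le> ennreal ((2 * (1/2) ^ n)\<^sup>2)"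
      by (rule Fatou)
    finally have "(norm (abs_L2 h - X n))\<^sup>2 \<le> (2 * (1/2) ^ n)\<^sup>2"
      by (subst (asm) ennreal_le_iff) simp_all
    then have "norm (abs_L2 h - X n) \<le> 2 * (1/2) ^ n"
      by (rule power2_le_imp_le) simp
    then show ?thesis
      by (simp add: norm_minus_commute)
  qed
  have "(\<lambda>n. 2 * (1/2 :: real) ^ n) \<longlonglongrightarrow> 2 * 0"
    by (intro tendsto_mult tendsto_const LIMSEQ_power_zero) simp
  then have "(\<lambda>n. 2 * (1/2 :: real) ^ n) \<longlonglongrightarrow> 0" by simp
  then have "(\<lambda>n. X n - abs_L2 h) \<longlonglongrightarrow> 0"
    by (rule Lim_null_comparison[rotated]) (simp add: bound)
  then show ?thesis
    by (auto simp: LIM_zero_iff convergent_def)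
qed

instance L2 :: complete_space
proof
  fix X :: "nat \<Rightarrow> L2" assume X: "Cauchy X"
  define P where "P n k \<longleftrightarrow> (\<forall>i\<ge>k. \<forall>j\<ge>k. dist (X i) (X j) < (1/2) ^ n)" for n k
  have P: "\<exists>k. P n k" for n
    using X unfolding Cauchy_def P_def by simp
  have "\<exists>r. \<forall>n. P n (r n) \<and> r n < r (Suc n)"
  proof (rule dependent_nat_choice)
    show "\<exists>k. P 0 k" by (rule P)
    fix k n
    obtain l where "P (Suc n) l"
      using P by blast
    then have "P (Suc n) (max l (Suc k))"
      by (auto simp: P_def)
    then show "\<exists>l. P (Suc n) l \<and> k < l"
      by (intro exI[of _ "max l (Suc k)"]) auto
  qed
  then obtain r where r: "\<And>n. P n (r n)" "\<And>n. r n < r (Suc n)" by blast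
  have mono: "strict_mono r"
    using r(2) by (simp add: strict_mono_Suc_iff)
  have "norm ((X \<circ> r) (Suc n) - (X \<circ> r) n) \<le> (1/2) ^ n" for n
    using r(1)[of n] r(2)[of n] by (auto simp: P_def dist_norm intro: less_imp_le)
  then have "convergent (X \<circ> r)"
    by (rule L2_fast_Cauchy_convergent)
  then show "convergent X"
    using Cauchy_converges_subseq[OF X mono] by (auto simp: convergent_def)
qed

lemma bounded_linear_fourier_coeff: "bounded_linear (\<lambda>F. fourier_coeff F k)"
  by (rule bounded_linear_intro[of _ 1])
     (auto simp: fourier_coeff_add fourier_coeff_scaleR scaleR_conv_of_real norm_fourier_coeff_le)

theorem Riesz_Fischer:
  assumes c: "(\<lambda>k. (cmod (c k))\<^sup>2) summable_on UNIV"
  obtains F where "\<And>k. fourier_coeff F k = c k"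
proof -
  define S where "S n = (\<Sum>k\<in>{-int n..int n}. scaleC_L2 (c k) (expo k))" for n
  define T where "T n = (\<Sum>k\<in>{-int n..int n}. (cmod (c k))\<^sup>2)" for n
  have S_diff: "(norm (S m - S n))\<^sup>2 = T m - T n" if "n \<le> m" for m n
  proof -
    have sub: "{-int n..int n} \<subseteq> {-int m..int m}"
      using that by auto
    have "S m - S n = (\<Sum>k\<in>{-int m..int m} - {-int n..int n}. scaleC_L2 (c k) (expo k))"
      unfolding S_def using sub by (simp add: sum_diff)
    moreover have "T m - T n = (\<Sum>k\<in>{-int m..int m} - {-int n..int n}. (cmod (c k))\<^sup>2)"
      unfolding T_def using sub by (simp add: sum_diff)
    ultimately show ?thesis
      by (simp add: norm_trig_sum)
  qed
  have "incseq T"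
    unfolding incseq_def T_def by (auto intro!: sum_mono2)
  moreover have "T n \<le> (\<Sum>\<^sub>\<infinity>k. (cmod (c k))\<^sup>2)" for n
    unfolding T_def using c by (intro finite_sum_le_infsum) auto
  ultimately have "Cauchy T"
    using incseq_convergent[of T] by (metis convergent_Cauchy convergent_def)
  have "Cauchy S"
  proof (rule metric_CauchyI)
    fix e :: real assume "0 < e"
    then obtain M where M: "\<And>m n. M \<le> m \<Longrightarrow> M \<le> n \<Longrightarrow> dist (T m) (T n) < e\<^sup>2"
      using metric_CauchyD[OF \<open>Cauchy T\<close>, of "e\<^sup>2"] by auto
    have less: "norm (S m - S n) < e" if "M \<le> n" "n \<le> m" for m n
    proof -
      have "(norm (S m - S n))\<^sup>2 < e\<^sup>2"
        using M[of m n] that by (simp add: S_diff dist_real_def)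
      then show ?thesis
        using \<open>0 < e\<close> by (simp add: power2_less_imp_less)
    qed
    have "dist (S m) (S n) < e" if "M \<le> m" "M \<le> n" for m n
      using less[of n m] less[of m n] that by (cases "n \<le> m") (auto simp: dist_norm norm_minus_commute)
    then show "\<exists>M. \<forall>m\<ge>M. \<forall>n\<ge>M. dist (S m) (S n) < e" by blast
  qed
  then obtain F where F: "S \<longlonglongrightarrow> F"
    using Cauchy_convergent[of S] unfolding convergent_def by blast
  have "fourier_coeff F k = c k" for k
  proof -
    have "(\<lambda>n. fourier_coeff (S n) k) \<longlonglongrightarrow> fourier_coeff F k"
      by (rule bounded_linear.tendsto[OF bounded_linear_fourier_coeff F])
    moreover have "\<forall>\<^sub>F n in sequentially. fourier_coeff (S n) k = c k"
      using eventually_ge_at_top[of "nat \<bar>k\<bar>"]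
    proof eventually_elim
      case (elim n)
      then have "k \<in> {-int n..int n}" by auto
      then show ?case
        unfolding S_def by (subst fourier_coeff_trig_sum) auto
    qed
    then have "(\<lambda>n. fourier_coeff (S n) k) \<longlonglongrightarrow> c k"
      by (rule tendsto_eventually)
    ultimately show ?thesis
      by (rule LIMSEQ_unique)
  qed
  then show thesis by (rule that)
qed

lemma fourier_coeff_Conv:
  assumes "bounded (range lam)"
  shows "fourier_coeff (Conv lam F) k = lam k * fourier_coeff F k"
proof -
  obtain B where B: "\<And>k. cmod (lam k) \<le> B"
    using assms by (auto simp: bounded_iff)
  have "(\<lambda>k. B\<^sup>2 * (cmod (fourier_coeff F k))\<^sup>2) summable_on UNIV"
    using has_sum_imp_summable[OF Parseval[of F]] by (rule summable_on_cmult_right)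
  then have "(\<lambda>k. (cmod (lam k * fourier_coeff F k))\<^sup>2) summable_on UNIV"
    by (rule summable_on_comparison_test)
       (auto simp: norm_mult power_mult_distrib intro!: mult_right_mono power_mono B)
  then obtain G where G: "\<And>k. fourier_coeff G k = lam k * fourier_coeff F k"
    by (rule Riesz_Fischer) blast
  have "Conv lam F = (\<Sum>\<^sub>\<infinity>k. scaleC_L2 (fourier_coeff G k) (expo k))"
    by (simp add: Conv_def G)
  also have "\<dots> = G"
    by (rule infsumI[OF Fourier_expansion])
  finally show ?thesis by (simp add: G)
qed

lemma has_sum_norm_Conv:
  assumes "bounded (range lam)"
  shows "((\<lambda>k. (cmod (lam k))\<^sup>2 * (cmod (fourier_coeff F k))\<^sup>2) has_sum (norm (Conv lam F))\<^sup>2) UNIV"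
  using Parseval[of "Conv lam F"]
  by (simp add: fourier_coeff_Conv[OF assms] norm_mult power_mult_distrib)

lemma Conv_add: "bounded (range lam) \<Longrightarrow> Conv lam (F + G) = Conv lam F + Conv lam G"
  by (rule L2_eqI) (simp add: fourier_coeff_Conv fourier_coeff_add distrib_left)

lemma Conv_diff: "bounded (range lam) \<Longrightarrow> Conv lam (F - G) = Conv lam F - Conv lam G"
  by (rule L2_eqI) (simp add: fourier_coeff_Conv fourier_coeff_diff right_diff_distrib)

lemma Conv_scaleC: "bounded (range lam) \<Longrightarrow> Conv lam (scaleC_L2 c F) = scaleC_L2 c (Conv lam F)"
  by (rule L2_eqI) (simp add: fourier_coeff_Conv fourier_coeff_scaleC)

lemma norm_Conv_le:
  assumes "\<And>k. cmod (lam k) \<le> B"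
  shows "norm (Conv lam F) \<le> B * norm F"
proof -
  have bdd: "bounded (range lam)"
    unfolding bounded_iff using assms by blast
  have B: "0 \<le> B"
    by (rule order_trans[OF norm_ge_zero assms[of 0]])
  have "((\<lambda>k. B\<^sup>2 * (cmod (fourier_coeff F k))\<^sup>2) has_sum B\<^sup>2 * (norm F)\<^sup>2) UNIV"
    by (intro has_sum_cmult_right Parseval)
  with has_sum_norm_Conv[OF bdd] have "(norm (Conv lam F))\<^sup>2 \<le> B\<^sup>2 * (norm F)\<^sup>2"
    by (rule has_sum_mono) (auto intro!: mult_right_mono power_mono assms)
  then show ?thesis
    using B power2_le_imp_le[of "norm (Conv lam F)" "B * norm F"] by (simp add: power_mult_distrib)
qed

lemma bounded_linear_Conv:
  assumes "bounded (range lam)"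
  shows "bounded_linear (Conv lam)"
proof -
  obtain B where B: "\<And>k. cmod (lam k) \<le> B"
    using assms by (auto simp: bounded_iff)
  show ?thesis
    using Conv_scaleC[OF assms, of "of_real _"] norm_Conv_le[of lam B, OF B]
    by (intro bounded_linear_intro[of _ B]) (auto simp: Conv_add[OF assms] scaleC_of_real mult.commute)
qed

section \<open>Cutoffs, modulations and interval means\<close>

lemma cutoff_abs_L2:
  "sq_integrable f \<Longrightarrow> Y \<in> sets torus \<Longrightarrow> cutoff Y (abs_L2 f) = abs_L2 (\<lambda>x. indicator Y x * f x)"
  by (simp add: cutoff.abs_eq)

lemma cutoff_idem [simp]: "cutoff Y (cutoff Y F) = cutoff Y F"
proof (transfer, goal_cases)
  case (1 Y f)
  have eq: "(\<lambda>x. indicator Y x * (indicator Y x * f x)) = (\<lambda>x. indicator Y x * f x)"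
    by (simp add: indicator_def fun_eq_iff)
  from 1 show ?case
    by (simp add: eq sq_integrable_indicator sq_integrable_zero)
qed

lemma cutoff_add: "cutoff Y (F + G) = cutoff Y F + cutoff Y G"
  by transfer
     (auto simp: ae_eq_def distrib_left sq_integrable_zero intro!: sq_integrable_indicator sq_integrable_add)

lemma cutoff_scaleR: "cutoff Y (r *\<^sub>R F) = r *\<^sub>R cutoff Y F"
proof (transfer, goal_cases)
  case (1 Y r f)
  have eq: "(\<lambda>x. indicator Y x * (of_real r * f x)) = (\<lambda>x. of_real r * (indicator Y x * f x))"
    by (simp add: mult.left_commute)
  from 1 show ?case
    by (simp add: eq sq_integrable_zero sq_integrable_indicator sq_integrable_cmult)
qed

lemma norm_cutoff_le: "norm (cutoff Y F) \<le> norm F"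
proof (cases "Y \<in> sets torus")
  case True
  obtain f where f: "sq_integrable f" "F = abs_L2 f"
    by (rule L2_cases)
  have "(LINT x|torus. (cmod (indicator Y x * f x))\<^sup>2) \<le> (LINT x|torus. (cmod (f x))\<^sup>2)"
    using f(1) sq_integrable_indicator[OF f(1) True]
    by (intro integral_mono) (auto simp: sq_integrable_def indicator_def)
  then show ?thesis
    using f sq_integrable_indicator[OF f(1) True] True by (simp add: cutoff_abs_L2 norm_abs_L2)
next
  case False
  then have "cutoff Y F = 0"
    by transfer (simp add: ae_eq_def sq_integrable_zero)
  then show ?thesis by simp
qed

lemma bounded_linear_cutoff: "bounded_linear (cutoff Y)"
  by (rule bounded_linear_intro[of _ 1]) (auto simp: cutoff_add cutoff_scaleR norm_cutoff_le)

lemma norm_cutoff_expo: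
  assumes "Y \<in> sets torus"
  shows "(norm (cutoff Y (expo n)))\<^sup>2 = measure torus Y"
proof -
  have "(norm (cutoff Y (expo n)))\<^sup>2 = (LINT x|torus. (cmod (indicator Y x * cis (of_int n * x)))\<^sup>2)"
    using assms
    by (simp add: expo_eq cutoff_abs_L2 norm_abs_L2 sq_integrable_cis sq_integrable_indicator)
  also have "\<dots> = (LINT x|torus. indicator Y x)"
    by (intro Bochner_Integration.integral_cong) (auto simp: indicator_def)
  also have "\<dots> = measure torus Y"
    using assms by simp
  finally show ?thesis .
qed

lemma sq_integrable_cis_mult:
  assumes "sq_integrable f"
  shows "sq_integrable (\<lambda>x. cis (of_int m * x) * f x)"
proof -
  have "(\<lambda>x. cis (of_int m * x)) \<in> borel_measurable torus"
    using sq_integrable_cis by (simp add: sq_integrable_def)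
  then show ?thesis
    using assms by (auto simp: sq_integrable_def norm_mult intro!: borel_measurable_times)
qed

lift_definition modulate :: "int \<Rightarrow> L2 \<Rightarrow> L2" is "\<lambda>m f x. cis (of_int m * x) * f x"
  by (auto simp: ae_eq_def sq_integrable_cis_mult)

lemma modulate_abs_L2:
  "sq_integrable f \<Longrightarrow> modulate m (abs_L2 f) = abs_L2 (\<lambda>x. cis (of_int m * x) * f x)"
  by (simp add: modulate.abs_eq)

lemma norm_modulate [simp]: "norm (modulate m F) = norm F"
  by transfer (simp add: norm_mult)

lemma fourier_coeff_modulate: "fourier_coeff (modulate m F) k = fourier_coeff F (k - m)"
proof (transfer fixing: m k, goal_cases)
  case (1 f)
  have "cis (of_int m * x) * f x * cis (- (of_int k * x)) = f x * cis (- (of_int (k - m) * x))" for x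
  proof -
    have "cis (of_int m * x) * cis (- (of_int k * x)) = cis (- (of_int (k - m) * x))"
      by (simp add: cis_mult algebra_simps)
    then show ?thesis by (metis mult.commute mult.left_commute)
  qed
  then show ?case by (simp only:)
qed

lemma cutoff_expo: "cutoff Y (expo n) = modulate n (cutoff Y (expo 0))"
proof (transfer fixing: Y n, goal_cases)
  case 1
  have "sq_integrable (\<lambda>x. indicator Y x * cis (of_int n * x))" if "Y \<in> sets torus"
    using that by (intro sq_integrable_indicator sq_integrable_cis)
  then show ?case
    by (auto simp: ae_eq_def sq_integrable_zero mult.commute)
qed

lemma has_sum_norm_Conv_modulate:
  assumes "bounded (range lam)"
  shows "((\<lambda>k. (cmod (lam (k + m)))\<^sup>2 * (cmod (fourier_coeff F k))\<^sup>2)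
    has_sum (norm (Conv lam (modulate m F)))\<^sup>2) UNIV"
  using Parseval[of "modulate (- m) (Conv lam (modulate m F))"]
  by (simp add: fourier_coeff_modulate fourier_coeff_Conv[OF assms] norm_mult power_mult_distrib)

lemma norm_cis_minus_1_le: "cmod (1 - cis t) \<le> \<bar>t\<bar>"
proof -
  have "cmod (1 - cis t) = 2 * \<bar>sin (t / 2)\<bar>"
    using dist_exp_i_1[of t] by (simp add: cis_conv_exp norm_minus_commute)
  then show ?thesis
    using abs_sin_x_le_abs_x[of "t / 2"] by simp
qed

lemma norm_cutoff_diff_modulate_le:
  assumes Y: "Y \<in> sets torus" "\<And>x. x \<in> Y \<Longrightarrow> \<bar>x - a\<bar> \<le> d" and "0 \<le> d"
  shows "norm (cutoff Y F - scaleC_L2 (cis (- (of_int m * a))) (modulate m (cutoff Y F)))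
    \<le> \<bar>of_int m\<bar> * d * norm (cutoff Y F)"
proof -
  obtain f where f: "sq_integrable f" "F = abs_L2 f"
    by (rule L2_cases)
  define g where "g x = indicator Y x * f x" for x
  have g: "sq_integrable g"
    unfolding g_def using f(1) Y(1) by (rule sq_integrable_indicator)
  have G: "cutoff Y F = abs_L2 g"
    using f Y(1) by (simp add: cutoff_abs_L2 g_def[abs_def])
  define h where "h x = g x - cis (- (of_int m * a)) * (cis (of_int m * x) * g x)" for x
  have h: "sq_integrable h"
    unfolding h_def by (intro sq_integrable_diff sq_integrable_cmult sq_integrable_cis_mult g)
  have H: "cutoff Y F - scaleC_L2 (cis (- (of_int m * a))) (modulate m (cutoff Y F)) = abs_L2 h"
    unfolding G h_def[abs_def]
    by (simp add: g modulate_abs_L2 scaleC_L2.abs_eq diff_abs_L2 sq_integrable_cis_mult sq_integrable_cmult)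
  have "(cmod (h x))\<^sup>2 \<le> (\<bar>of_int m\<bar> * d)\<^sup>2 * (cmod (g x))\<^sup>2" for x
  proof (cases "x \<in> Y")
    case True
    have "h x = (1 - cis (of_int m * (x - a))) * g x"
    proof -
      have "cis (of_int m * (x - a)) = cis (- (of_int m * a)) * cis (of_int m * x)"
        by (simp add: cis_mult algebra_simps)
      then show ?thesis
        by (simp add: h_def left_diff_distrib)
    qed
    then have "cmod (h x) \<le> \<bar>of_int m * (x - a)\<bar> * cmod (g x)"
      using norm_cis_minus_1_le by (simp add: norm_mult mult_right_mono)
    also have "\<dots> \<le> \<bar>of_int m\<bar> * d * cmod (g x)"
      using Y(2)[OF True] by (intro mult_right_mono) (auto simp: abs_mult intro: mult_left_mono)
    finally show ?thesis
      by (metis norm_ge_zero power_mono power_mult_distrib)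
  next
    case False
    then show ?thesis by (simp add: h_def g_def)
  qed
  then have "(LINT x|torus. (cmod (h x))\<^sup>2) \<le> (LINT x|torus. (\<bar>of_int m\<bar> * d)\<^sup>2 * (cmod (g x))\<^sup>2)"
    using g h by (intro integral_mono) (auto simp: sq_integrable_def)
  then have "(norm (abs_L2 h))\<^sup>2 \<le> (\<bar>of_int m\<bar> * d * norm (abs_L2 g))\<^sup>2"
    using g h by (simp add: norm_abs_L2 power_mult_distrib)
  then have "norm (abs_L2 h) \<le> \<bar>of_int m\<bar> * d * norm (abs_L2 g)"
    by (rule power2_le_imp_le) (use \<open>0 \<le> d\<close> in simp)
  then show ?thesis
    by (simp only: H) (simp only: G)
qed

definition mean :: "(int \<Rightarrow> complex) \<Rightarrow> int set \<Rightarrow> real" where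
  "mean lam I = (1 / real (card I)) * (\<Sum>k\<in>I. (cmod (lam k))\<^sup>2)"

definition long_intervals :: "nat \<Rightarrow> int set set" where
  "long_intervals N = {I. \<exists>n m. n \<le> m \<and> I = {n..m} \<and> N \<le> card I}"

definition sup_mean :: "(int \<Rightarrow> complex) \<Rightarrow> nat \<Rightarrow> real" where
  "sup_mean lam N = (SUP I\<in>long_intervals N. mean lam I)"

lemma rho_eq: "rho lam = lim (sup_mean lam)"
  by (simp add: rho_def sup_mean_def[abs_def] mean_def long_intervals_def)

lemma mean_le:
  assumes "\<And>k. cmod (lam k) \<le> B"
  shows "mean lam I \<le> B\<^sup>2"
proof (cases "card I = 0")
  case False
  have "(\<Sum>k\<in>I. (cmod (lam k))\<^sup>2) \<le> (\<Sum>k\<in>I. B\<^sup>2)"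
    by (intro sum_mono power_mono assms norm_ge_zero)
  then show ?thesis
    using False by (simp add: mean_def divide_le_eq mult.commute)
qed (simp add: mean_def)

lemma mean_le_sup_mean:
  assumes "bounded (range lam)" "I \<in> long_intervals N"
  shows "mean lam I \<le> sup_mean lam N"
proof -
  obtain B where "\<And>k. cmod (lam k) \<le> B"
    using assms(1) by (auto simp: bounded_iff)
  then have "bdd_above (mean lam ` long_intervals N)"
    by (intro bdd_aboveI2[of _ _ "B\<^sup>2"] mean_le)
  then show ?thesis
    unfolding sup_mean_def using assms(2) by (intro cSUP_upper)
qed

lemma interval_in_long_intervals:
  assumes "N \<le> M" "0 < M"
  shows "{k..k + int M - 1} \<in> long_intervals N"
  using assms unfolding long_intervals_def by (auto intro!: exI[of _ k] exI[of _ "k + int M - 1"])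

lemma long_intervals_nonempty: "long_intervals N \<noteq> {}"
  using interval_in_long_intervals[of N "Suc N" 0] by auto

lemma sup_mean_tendsto_rho:
  assumes "bounded (range lam)"
  shows "sup_mean lam \<longlonglongrightarrow> rho lam" and "rho lam \<le> sup_mean lam N" and "0 \<le> rho lam"
proof -
  have dec: "decseq (sup_mean lam)"
    unfolding decseq_def
  proof (intro allI impI)
    fix m n :: nat assume "m \<le> n"
    then have "long_intervals n \<subseteq> long_intervals m"
      by (force simp: long_intervals_def)
    then show "sup_mean lam n \<le> sup_mean lam m"
      unfolding sup_mean_def[of lam n]
      by (intro cSUP_least long_intervals_nonempty mean_le_sup_mean[OF assms]) auto
  qed
  have nonneg: "0 \<le> sup_mean lam N" for N
  proof -
    obtain I where I: "I \<in> long_intervals N"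
      using long_intervals_nonempty by blast
    have "0 \<le> mean lam I"
      by (simp add: mean_def sum_nonneg)
    also have "\<dots> \<le> sup_mean lam N"
      by (rule mean_le_sup_mean[OF assms I])
    finally show ?thesis .
  qed
  obtain L where L: "sup_mean lam \<longlonglongrightarrow> L" "\<forall>N. L \<le> sup_mean lam N"
    using decseq_convergent[OF dec, of 0] nonneg by blast
  have "rho lam = L"
    unfolding rho_eq using L(1) by (rule limI)
  then show "sup_mean lam \<longlonglongrightarrow> rho lam" and "rho lam \<le> sup_mean lam N"
    using L by auto
  show "0 \<le> rho lam"
    unfolding \<open>rho lam = L\<close> using L(1) nonneg by (intro LIMSEQ_le_const[of "sup_mean lam"]) auto
qed

section \<open>The two estimates\<close>

lemma bounded_linear_Conv_cutoff:
  "bounded (range lam) \<Longrightarrow> bounded_linear (Conv lam \<circ> cutoff Y)"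
  unfolding comp_def by (rule bounded_linear_compose[OF bounded_linear_Conv bounded_linear_cutoff])

lemma has_sum_finite_sum:
  fixes f :: "'i \<Rightarrow> 'a \<Rightarrow> 'b :: {topological_comm_monoid_add, t2_space}"
  assumes "\<And>i. i \<in> I \<Longrightarrow> (f i has_sum S i) A"
  shows "((\<lambda>x. \<Sum>i\<in>I. f i x) has_sum (\<Sum>i\<in>I. S i)) A"
  using assms by (induction I rule: infinite_finite_induct) (auto intro: has_sum_add)

lemma M_part_nonneg: "0 \<le> M_part J Y W"
  unfolding M_part_def by (intro sum_nonneg mult_nonneg_nonneg) auto

lemma sum_interval_shift_ge:
  fixes g :: "int \<Rightarrow> real"
  assumes g: "\<And>k. 0 \<le> g k" "\<And>k. g k \<le> C"
  shows "(\<Sum>k\<in>{n..m}. g k) - \<bar>of_int q\<bar> * C \<le> (\<Sum>k\<in>{n..m}. g (k + q))"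
proof -
  let ?D = "{n..m} - {n + q..m + q}"
  have C: "0 \<le> C"
    using g[of 0] by linarith
  have "?D \<subseteq> {n..<n + q} \<union> {m + q<..m}"
    by auto
  then have "card ?D \<le> card ({n..<n + q} \<union> {m + q<..m})"
    by (intro card_mono) auto
  also have "\<dots> \<le> card {n..<n + q} + card {m + q<..m}"
    by (rule card_Un_le)
  also have "\<dots> = nat \<bar>q\<bar>"
    by auto
  finally have card: "real (card ?D) \<le> \<bar>of_int q\<bar>"
    by linarith
  have "(\<Sum>k\<in>{n..m}. g k) \<le> (\<Sum>k\<in>{n + q..m + q} \<union> ?D. g k)"
    using g(1) by (intro sum_mono2) auto
  also have "\<dots> = (\<Sum>k\<in>{n + q..m + q}. g k) + (\<Sum>k\<in>?D. g k)"
    by (intro sum.union_disjoint) auto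
  also have "(\<Sum>k\<in>?D. g k) \<le> real (card ?D) * C"
    using g(2) by (intro sum_bounded_above)
  also have "\<dots> \<le> \<bar>of_int q\<bar> * C"
    using card C by (rule mult_right_mono)
  also have "(\<Sum>k\<in>{n + q..m + q}. g k) = (\<Sum>k\<in>{n..m}. g (k + q))"
    by (rule sum.reindex_bij_witness[of _ "\<lambda>k. k + q" "\<lambda>k. k - q"]) auto
  finally show ?thesis by simp
qed

text \<open>Testing \<^term>\<open>Conv lam \<circ> cutoff (Y j)\<close> on the functions \<open>e\<^sup>i\<^sup>n\<^sup>x 1\<^sub>Y\<close> makes \<open>M_part\<close> dominate weighted
  means of \<open>\<bar>lam\<bar>\<^sup>2\<close> around every \<open>n\<close>; the weights do not depend on \<open>n\<close>.\<close>

lemma M_part_ge_weighted_sum: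
  assumes lam: "bounded (range lam)" and Y: "\<And>j. j \<in> {1..J} \<Longrightarrow> Y j \<in> sets torus" and "finite K"
  shows "(\<Sum>j=1..J. \<Sum>q\<in>K. (cmod (lam (n + q)))\<^sup>2 * (cmod (fourier_coeff (cutoff (Y j) (expo 0)) q))\<^sup>2)
    \<le> M_part J Y (Conv lam)"
  unfolding M_part_def
proof (rule sum_mono)
  fix j assume j: "j \<in> {1..J}"
  let ?F = "cutoff (Y j) (expo n)"
  have "((\<lambda>q. (cmod (lam (n + q)))\<^sup>2 * (cmod (fourier_coeff (cutoff (Y j) (expo 0)) q))\<^sup>2)
      has_sum (norm (Conv lam ?F))\<^sup>2) UNIV"
    using has_sum_norm_Conv_modulate[OF lam, of n "cutoff (Y j) (expo 0)"]
    by (simp add: cutoff_expo[of _ n] add.commute)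
  then have "(\<Sum>q\<in>K. (cmod (lam (n + q)))\<^sup>2 * (cmod (fourier_coeff (cutoff (Y j) (expo 0)) q))\<^sup>2)
      \<le> (norm (Conv lam ?F))\<^sup>2"
    using \<open>finite K\<close> finite_sum_le_has_sum by (metis (no_types, lifting) mult_nonneg_nonneg subset_UNIV zero_le_power2)
  also have "norm (Conv lam ?F) \<le> onorm (Conv lam \<circ> cutoff (Y j)) * norm ?F"
    using onorm[OF bounded_linear_Conv_cutoff[OF lam], of "Y j" ?F] by simp
  then have "(norm (Conv lam ?F))\<^sup>2 \<le> (onorm (Conv lam \<circ> cutoff (Y j)) * norm ?F)\<^sup>2"
    by (intro power_mono) auto
  also have "\<dots> = measure torus (Y j) * (onorm (Conv lam \<circ> cutoff (Y j)))\<^sup>2"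
    by (simp add: power_mult_distrib norm_cutoff_expo[OF Y[OF j]] mult.commute)
  finally show "(\<Sum>q\<in>K. (cmod (lam (n + q)))\<^sup>2 * (cmod (fourier_coeff (cutoff (Y j) (expo 0)) q))\<^sup>2)
    \<le> measure torus (Y j) * (onorm (Conv lam \<circ> cutoff (Y j)))\<^sup>2" .
qed

lemma M_part_ge_rho_finite:
  assumes lam: "bounded (range lam)" and Y: "\<And>j. j \<in> {1..J} \<Longrightarrow> Y j \<in> sets torus" and K: "finite K"
  shows "(\<Sum>q\<in>K. \<Sum>j=1..J. (cmod (fourier_coeff (cutoff (Y j) (expo 0)) q))\<^sup>2) * rho lam
    \<le> M_part J Y (Conv lam)"
proof -
  define w where "w q = (\<Sum>j=1..J. (cmod (fourier_coeff (cutoff (Y j) (expo 0)) q))\<^sup>2)" for q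
  define P where "P = sum w K"
  define M where "M = M_part J Y (Conv lam)"
  obtain B where B: "\<And>k. cmod (lam k) \<le> B"
    using lam by (auto simp: bounded_iff)
  have w: "0 \<le> w q" for q
    by (simp add: w_def sum_nonneg)
  have P: "0 \<le> P"
    by (simp add: P_def sum_nonneg w)
  have M: "0 \<le> M"
    by (simp add: M_def M_part_nonneg)
  define R where "R = (\<Sum>q\<in>K. \<bar>of_int q\<bar> :: real)"
  have R: "\<bar>of_int q\<bar> \<le> R" if "q \<in> K" for q
    unfolding R_def using that K by (intro member_le_sum) auto
  have weighted: "(\<Sum>q\<in>K. w q * (cmod (lam (k + q)))\<^sup>2) \<le> M" for k
  proof -
    have "(\<Sum>q\<in>K. w q * (cmod (lam (k + q)))\<^sup>2)
        = (\<Sum>j=1..J. \<Sum>q\<in>K. (cmod (lam (k + q)))\<^sup>2 * (cmod (fourier_coeff (cutoff (Y j) (expo 0)) q))\<^sup>2)"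
      by (subst sum.swap) (simp add: w_def sum_distrib_left mult.commute)
    then show ?thesis
      using M_part_ge_weighted_sum[OF lam Y K, where n = k] by (simp add: M_def)
  qed
  have mean_le: "P * mean lam I \<le> M + P * (R * B\<^sup>2) / real (Suc N)" if long: "I \<in> long_intervals (Suc N)" for I N
  proof -
    obtain n m where I: "I = {n..m}" "Suc N \<le> card I"
      using long unfolding long_intervals_def by blast
    define s where "s = (\<Sum>k\<in>I. (cmod (lam k))\<^sup>2)"
    have "P * (s - R * B\<^sup>2) = (\<Sum>q\<in>K. w q * (s - R * B\<^sup>2))"
      by (simp add: P_def sum_distrib_right)
    also have "\<dots> \<le> (\<Sum>q\<in>K. w q * (\<Sum>k\<in>I. (cmod (lam (k + q)))\<^sup>2))"
    proof (intro sum_mono mult_left_mono w)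
      fix q assume "q \<in> K"
      have "s - R * B\<^sup>2 \<le> s - \<bar>of_int q\<bar> * B\<^sup>2"
        using R[OF \<open>q \<in> K\<close>] by (simp add: mult_right_mono)
      also have "\<dots> \<le> (\<Sum>k\<in>I. (cmod (lam (k + q)))\<^sup>2)"
        unfolding s_def I(1) by (intro sum_interval_shift_ge power_mono B) auto
      finally show "s - R * B\<^sup>2 \<le> (\<Sum>k\<in>I. (cmod (lam (k + q)))\<^sup>2)" .
    qed
    also have "\<dots> = (\<Sum>k\<in>I. \<Sum>q\<in>K. w q * (cmod (lam (k + q)))\<^sup>2)"
      by (simp add: sum_distrib_left sum.swap[of _ I])
    also have "\<dots> \<le> real (card I) * M"
      using weighted by (intro sum_bounded_above)
    finally have "P * s \<le> real (card I) * M + P * (R * B\<^sup>2)"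
      by (simp add: right_diff_distrib)
    moreover have card: "0 < real (card I)"
      using I(2) by simp
    ultimately have "P * mean lam I \<le> M + P * (R * B\<^sup>2) / real (card I)"
      by (simp add: mean_def s_def field_simps)
    also have "P * (R * B\<^sup>2) / real (card I) \<le> P * (R * B\<^sup>2) / real (Suc N)"
    proof (intro divide_left_mono)
      show "0 \<le> P * (R * B\<^sup>2)"
        using P by (simp add: R_def sum_nonneg)
    qed (use I(2) in auto)
    finally show ?thesis by simp
  qed
  show ?thesis
  proof (cases "P = 0")
    case True
    then show ?thesis
      using M by (simp add: P_def w_def M_def)
  next
    case False
    with P have pos: "0 < P" by simp
    have "rho lam \<le> (M + P * (R * B\<^sup>2) / real (Suc N)) / P" for N
    proof -
      have "rho lam \<le> sup_mean lam (Suc N)"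
        by (rule sup_mean_tendsto_rho(2)[OF lam])
      also have "\<dots> \<le> (M + P * (R * B\<^sup>2) / real (Suc N)) / P"
        unfolding sup_mean_def using mean_le pos
        by (intro cSUP_least long_intervals_nonempty) (simp add: pos_le_divide_eq mult.commute)
      finally show ?thesis .
    qed
    moreover have "(\<lambda>N. (M + P * (R * B\<^sup>2) / real (Suc N)) / P) \<longlonglongrightarrow> (M + 0) / P"
    proof (intro tendsto_divide tendsto_add tendsto_const)
      show "(\<lambda>N. P * (R * B\<^sup>2) / real (Suc N)) \<longlonglongrightarrow> 0"
        using LIMSEQ_Suc[OF lim_const_over_n[of "P * (R * B\<^sup>2)"]] by simp
    qed (use pos in simp)
    ultimately have "rho lam \<le> (M + 0) / P"
      by (intro LIMSEQ_le_const) auto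
    then show ?thesis
      using pos by (simp add: pos_le_divide_eq mult.commute P_def w_def M_def)
  qed
qed

lemma M_part_ge_rho:
  assumes lam: "bounded (range lam)" and part: "is_partition J Y"
  shows "rho lam \<le> M_part J Y (Conv lam)"
proof -
  have Y: "Y j \<in> sets torus" if "j \<in> {1..J}" for j
    using part that by (simp add: is_partition_def)
  have "1 = measure torus (space torus)"
    by (simp add: measure_torus_space)
  also have "\<dots> \<le> measure torus ((space torus - (\<Union>j\<in>{1..J}. Y j)) \<union> (\<Union>j\<in>{1..J}. Y j))"
    using Y by (intro torus.finite_measure_mono) auto
  also have "\<dots> \<le> measure torus (space torus - (\<Union>j\<in>{1..J}. Y j)) + measure torus (\<Union>j\<in>{1..J}. Y j)"
    using Y by (intro measure_Un_le) auto
  also have "\<dots> \<le> 0 + (\<Sum>j=1..J. measure torus (Y j))"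
    using part Y by (intro add_mono measure_UNION_le) (auto simp: is_partition_def)
  finally have total: "1 \<le> (\<Sum>j=1..J. measure torus (Y j))"
    by simp
  have "((\<lambda>q. \<Sum>j=1..J. (cmod (fourier_coeff (cutoff (Y j) (expo 0)) q))\<^sup>2)
      has_sum (\<Sum>j=1..J. (norm (cutoff (Y j) (expo 0)))\<^sup>2)) UNIV"
    by (intro has_sum_finite_sum Parseval)
  also have "(\<Sum>j=1..J. (norm (cutoff (Y j) (expo 0)))\<^sup>2) = (\<Sum>j=1..J. measure torus (Y j))"
    by (intro sum.cong refl norm_cutoff_expo Y)
  finally have "((\<lambda>K. (\<Sum>q\<in>K. \<Sum>j=1..J. (cmod (fourier_coeff (cutoff (Y j) (expo 0)) q))\<^sup>2) * rho lam)
      \<longlongrightarrow> (\<Sum>j=1..J. measure torus (Y j)) * rho lam) (finite_subsets_at_top UNIV)"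
    unfolding has_sum_def by (rule tendsto_mult_right)
  then have "(\<Sum>j=1..J. measure torus (Y j)) * rho lam \<le> M_part J Y (Conv lam)"
  proof (rule tendsto_upperbound)
    show "\<forall>\<^sub>F K in finite_subsets_at_top UNIV.
        (\<Sum>q\<in>K. \<Sum>j=1..J. (cmod (fourier_coeff (cutoff (Y j) (expo 0)) q))\<^sup>2) * rho lam
          \<le> M_part J Y (Conv lam)"
      using M_part_ge_rho_finite[OF lam Y] by (auto simp: eventually_finite_subsets_at_top)
  qed simp
  moreover have "1 * rho lam \<le> (\<Sum>j=1..J. measure torus (Y j)) * rho lam"
    using total sup_mean_tendsto_rho(3)[OF lam] by (rule mult_right_mono)
  ultimately show ?thesis by simp
qed

text \<open>The Fourier coefficients of a function supported on a short arc vary slowly up to a phase,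
  so \<open>\<bar>lam\<bar>\<^sup>2\<close> may be replaced by its means over intervals of length \<open>N\<close>.\<close>

lemma norm_Conv_cutoff_short_arc:
  assumes B: "\<And>k. cmod (lam k) \<le> B" and N: "0 < N"
    and Y: "Y \<in> sets torus" "\<And>x. x \<in> Y \<Longrightarrow> \<bar>x - a\<bar> \<le> d" and d: "0 \<le> d"
  shows "(norm (Conv lam (cutoff Y F)))\<^sup>2
    \<le> (sup_mean lam N + 2 * B * (B * (real N * d)) + (B * (real N * d))\<^sup>2) * (norm (cutoff Y F))\<^sup>2"
proof -
  have lam: "bounded (range lam)"
    unfolding bounded_iff using B by blast
  have B0: "0 \<le> B"
    by (rule order_trans[OF norm_ge_zero B[of 0]])
  define G where "G = cutoff Y F"
  define e where "e = B * (real N * d)"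
  define b where "b m = norm (Conv lam (modulate (int m) G))" for m
  have e: "0 \<le> e"
    using B0 d by (simp add: e_def)
  have step: "(norm (Conv lam G))\<^sup>2 \<le> (b m)\<^sup>2 + (2 * B * e + e\<^sup>2) * (norm G)\<^sup>2" if "m < N" for m
  proof -
    define H where "H = scaleC_L2 (cis (- (of_int (int m) * a))) (modulate (int m) G)"
    have "norm (G - H) \<le> \<bar>of_int (int m)\<bar> * d * norm G"
      unfolding G_def H_def using Y d by (rule norm_cutoff_diff_modulate_le)
    also have "\<dots> \<le> real N * d * norm G"
      using that d by (intro mult_right_mono) auto
    finally have GH: "norm (G - H) \<le> real N * d * norm G" .
    have "norm (Conv lam (G - H)) \<le> B * norm (G - H)"
      using B by (rule norm_Conv_le)
    also have "\<dots> \<le> e * norm G"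
      using GH B0 mult_left_mono[OF GH B0] by (simp add: e_def mult.assoc)
    finally have 1: "norm (Conv lam (G - H)) \<le> e * norm G" .
    have 2: "norm (Conv lam H) = b m"
      by (simp add: H_def b_def Conv_scaleC[OF lam] norm_scaleC)
    have "norm (Conv lam G) \<le> b m + e * norm G"
      using norm_triangle_ineq[of "Conv lam H" "Conv lam (G - H)"] 1 2
      by (simp add: Conv_diff[OF lam])
    then have "(norm (Conv lam G))\<^sup>2 \<le> (b m + e * norm G)\<^sup>2"
      by (intro power_mono) auto
    also have "\<dots> = (b m)\<^sup>2 + 2 * b m * (e * norm G) + e\<^sup>2 * (norm G)\<^sup>2"
      by (simp add: power2_sum power_mult_distrib)
    also have "2 * b m * (e * norm G) \<le> 2 * (B * norm G) * (e * norm G)"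
      using norm_Conv_le[of lam B "modulate (int m) G", OF B] e
      by (intro mult_right_mono) (auto simp: b_def)
    finally show ?thesis
      by (simp add: algebra_simps power2_eq_square)
  qed
  have "((\<lambda>k. \<Sum>m<N. (cmod (lam (k + int m)))\<^sup>2 * (cmod (fourier_coeff G k))\<^sup>2)
      has_sum (\<Sum>m<N. (b m)\<^sup>2)) UNIV"
    unfolding b_def by (intro has_sum_finite_sum has_sum_norm_Conv_modulate[OF lam])
  moreover have "((\<lambda>k. (real N * sup_mean lam N) * (cmod (fourier_coeff G k))\<^sup>2)
      has_sum (real N * sup_mean lam N) * (norm G)\<^sup>2) UNIV"
    by (intro has_sum_cmult_right Parseval)
  ultimately have sum_b: "(\<Sum>m<N. (b m)\<^sup>2) \<le> (real N * sup_mean lam N) * (norm G)\<^sup>2"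
  proof (rule has_sum_mono)
    fix k
    have "(\<Sum>m<N. (cmod (lam (k + int m)))\<^sup>2) = (\<Sum>l\<in>{k..k + int N - 1}. (cmod (lam l))\<^sup>2)"
      by (rule sum.reindex_bij_witness[of _ "\<lambda>l. nat (l - k)" "\<lambda>m. k + int m"]) auto
    also have "\<dots> = real N * mean lam {k..k + int N - 1}"
      using N by (simp add: mean_def)
    also have "\<dots> \<le> real N * sup_mean lam N"
      using N by (intro mult_left_mono mean_le_sup_mean lam interval_in_long_intervals) auto
    finally show "(\<Sum>m<N. (cmod (lam (k + int m)))\<^sup>2 * (cmod (fourier_coeff G k))\<^sup>2)
        \<le> (real N * sup_mean lam N) * (cmod (fourier_coeff G k))\<^sup>2"
      by (simp add: mult_right_mono flip: sum_distrib_right)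
  qed
  have "real N * (norm (Conv lam G))\<^sup>2 = (\<Sum>m<N. (norm (Conv lam G))\<^sup>2)"
    by simp
  also have "\<dots> \<le> (\<Sum>m<N. (b m)\<^sup>2 + (2 * B * e + e\<^sup>2) * (norm G)\<^sup>2)"
    by (intro sum_mono step) simp
  also have "\<dots> = (\<Sum>m<N. (b m)\<^sup>2) + real N * ((2 * B * e + e\<^sup>2) * (norm G)\<^sup>2)"
    by (simp add: sum.distrib)
  also have "\<dots> \<le> (real N * sup_mean lam N) * (norm G)\<^sup>2 + real N * ((2 * B * e + e\<^sup>2) * (norm G)\<^sup>2)"
    using sum_b by (rule add_right_mono)
  also have "\<dots> = real N * ((sup_mean lam N + 2 * B * e + e\<^sup>2) * (norm G)\<^sup>2)"
    by (simp add: algebra_simps)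
  finally show ?thesis
    using N by (simp add: G_def e_def)
qed

lemma
  assumes "0 \<le> a" "a \<le> b" "b \<le> 2*pi"
  shows interval_sets_torus: "{a..<b} \<in> sets torus"
    and measure_torus_interval: "measure torus {a..<b} = (b - a) / (2*pi)"
proof -
  have sub: "{a..<b} \<inter> {0..<2*pi} = {a..<b}"
    using assms by auto
  have 1: "{a..<b} \<in> sets (lebesgue_on {0..<2*pi})"
    using assms by (auto simp: sets_restrict_space_iff)
  then show "{a..<b} \<in> sets torus"
    by (simp add: torus_def)
  have "emeasure torus {a..<b} = ennreal (1 / (2*pi)) * emeasure (lebesgue_on {0..<2*pi}) {a..<b}"
    unfolding torus_def using 1 by (subst emeasure_density_const) auto
  also have "emeasure (lebesgue_on {0..<2*pi}) {a..<b} = ennreal (b - a)"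
    using assms by (subst emeasure_restrict_space) auto
  also have "ennreal (1 / (2*pi)) * ennreal (b - a) = ennreal ((b - a) / (2*pi))"
    using assms by (simp flip: ennreal_mult)
  finally show "measure torus {a..<b} = (b - a) / (2*pi)"
    using assms by (simp add: measure_def)
qed

lemma mu_norm_le_sqrt_M_part:
  assumes "is_partition J Y"
  shows "mu_norm W \<le> sqrt (M_part J Y W)"
  unfolding mu_norm_def
proof (rule cInf_lower)
  show "bdd_below {sqrt (M_part J Y W) |J Y. is_partition J Y}"
    by (rule bdd_belowI[of _ 0]) (auto simp: M_part_nonneg)
qed (use assms in blast)

definition arc :: "nat \<Rightarrow> nat \<Rightarrow> real set" where
  "arc J j = {2*pi * (real j - 1) / real J ..< 2*pi * real j / real J}"

lemma
  assumes "j \<in> {1..J}"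
  shows sets_arc: "arc J j \<in> sets torus" and measure_arc: "measure torus (arc J j) = 1 / real J"
proof -
  have J: "0 < real J" "1 \<le> real j" "real j \<le> real J"
    using assms by auto
  have bounds: "0 \<le> 2*pi * (real j - 1) / real J" "2*pi * (real j - 1) / real J \<le> 2*pi * real j / real J"
    "2*pi * real j / real J \<le> 2*pi"
    using J by (auto simp: field_simps)
  show "arc J j \<in> sets torus"
    unfolding arc_def using bounds by (rule interval_sets_torus)
  show "measure torus (arc J j) = 1 / real J"
    unfolding arc_def using J by (subst measure_torus_interval[OF bounds]) (simp add: field_simps)
qed

lemma is_partition_arc:
  assumes "0 < J"
  shows "is_partition J (arc J)"
  unfolding is_partition_def
proof (intro conjI ballI impI)
  show "arc J j \<in> sets torus" if "j \<in> {1..J}" for j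
    using that by (rule sets_arc)
  have "space torus \<subseteq> (\<Union>j\<in>{1..J}. arc J j)"
  proof
    fix x assume "x \<in> space torus"
    then have x: "0 \<le> x" "x < 2*pi"
      by (auto simp: space_torus)
    define y where "y = x * real J / (2*pi)"
    have y: "0 \<le> y" "y < real J"
      using x assms by (auto simp: y_def field_simps)
    define j where "j = Suc (nat \<lfloor>y\<rfloor>)"
    have j: "real j - 1 \<le> y" "y < real j"
      unfolding j_def using y by linarith+
    then have "real j < real J + 1"
      using y(2) by linarith
    then have "j \<in> {1..J}"
      by (simp add: j_def)
    moreover have "x \<in> arc J j"
      using j assms by (auto simp: arc_def y_def field_simps)
    ultimately show "x \<in> (\<Union>j\<in>{1..J}. arc J j)" by blast
  qed
  then show "measure torus (space torus - (\<Union>j\<in>{1..J}. arc J j)) = 0"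
    by (simp add: Diff_eq_empty_iff[THEN iffD2])
  have disjoint: "arc J j \<inter> arc J k = {}" if "j < k" for j k
  proof -
    have "real j \<le> real k - 1"
      using that by linarith
    then have "2*pi * real j / real J \<le> 2*pi * (real k - 1) / real J"
      by (intro divide_right_mono mult_left_mono) auto
    then show ?thesis
      by (auto simp: arc_def)
  qed
  show "measure torus (arc J j \<inter> arc J k) = 0" if "j \<noteq> k" for j k
    using that disjoint[of j k] disjoint[of k j] by (cases "j < k") (auto simp: Int_commute)
qed

lemma mu_norm_nonneg: "0 \<le> mu_norm W"
  unfolding mu_norm_def
proof (rule cInf_greatest)
  show "{sqrt (M_part J Y W) |J Y. is_partition J Y} \<noteq> {}"
    using is_partition_arc[of 1] by auto
qed (auto simp: M_part_nonneg)

lemma mu_norm_Conv_le: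
  assumes B: "\<And>k. cmod (lam k) \<le> B" and N: "0 < N" and J: "0 < J"
  shows "(mu_norm (Conv lam))\<^sup>2
    \<le> sup_mean lam N + 2 * B * (B * (real N * (2*pi / real J))) + (B * (real N * (2*pi / real J)))\<^sup>2"
    (is "_ \<le> ?c")
proof -
  have lam: "bounded (range lam)"
    unfolding bounded_iff using B by blast
  have B0: "0 \<le> B"
    by (rule order_trans[OF norm_ge_zero B[of 0]])
  have c: "0 \<le> ?c"
    using sup_mean_tendsto_rho(2,3)[OF lam] B0
    by (intro add_nonneg_nonneg) (auto intro: order_trans)
  have "measure torus (arc J j) * (onorm (Conv lam \<circ> cutoff (arc J j)))\<^sup>2 \<le> 1 / real J * ?c"
    if j: "j \<in> {1..J}" for j
  proof -
    have near: "\<bar>x - 2*pi * (real j - 1) / real J\<bar> \<le> 2*pi / real J" if "x \<in> arc J j" for x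
      using that J by (auto simp: arc_def abs_le_iff field_simps)
    have "norm ((Conv lam \<circ> cutoff (arc J j)) F) \<le> sqrt ?c * norm F" for F
    proof (rule power2_le_imp_le)
      have "(norm (Conv lam (cutoff (arc J j) F)))\<^sup>2 \<le> ?c * (norm (cutoff (arc J j) F))\<^sup>2"
        using J by (intro norm_Conv_cutoff_short_arc[OF B N sets_arc[OF j] near]) auto
      also have "\<dots> \<le> ?c * (norm F)\<^sup>2"
        using c by (intro mult_left_mono power_mono norm_cutoff_le) auto
      also have "\<dots> = (sqrt ?c * norm F)\<^sup>2"
        using c by (simp only: power_mult_distrib real_sqrt_pow2)
      finally show "(norm ((Conv lam \<circ> cutoff (arc J j)) F))\<^sup>2 \<le> (sqrt ?c * norm F)\<^sup>2"
        by (simp only: comp_apply)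
      show "0 \<le> sqrt ?c * norm F"
        using c by (intro mult_nonneg_nonneg real_sqrt_ge_zero norm_ge_zero)
    qed
    then have "onorm (Conv lam \<circ> cutoff (arc J j)) \<le> sqrt ?c"
      using real_sqrt_ge_zero[OF c] by (intro onorm_bound)
    then have "(onorm (Conv lam \<circ> cutoff (arc J j)))\<^sup>2 \<le> (sqrt ?c)\<^sup>2"
      by (intro power_mono onorm_pos_le bounded_linear_Conv_cutoff lam)
    also have "\<dots> = ?c"
      using c by (rule real_sqrt_pow2)
    finally show ?thesis
      unfolding measure_arc[OF j] by (rule mult_left_mono) simp
  qed
  then have "M_part J (arc J) (Conv lam) \<le> (\<Sum>j=1..J. 1 / real J * ?c)"
    unfolding M_part_def by (rule sum_mono)
  also have "\<dots> = ?c"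
    using J by simp
  finally have M: "M_part J (arc J) (Conv lam) \<le> ?c" .
  have "(mu_norm (Conv lam))\<^sup>2 \<le> (sqrt (M_part J (arc J) (Conv lam)))\<^sup>2"
    by (intro power_mono mu_norm_le_sqrt_M_part is_partition_arc J mu_norm_nonneg)
  also have "\<dots> = M_part J (arc J) (Conv lam)"
    by (simp add: M_part_nonneg)
  finally show ?thesis
    using M by (rule order_trans)
qed

theorem proposition6p1:
  fixes lam :: "int \<Rightarrow> complex"
  assumes "bounded (range lam)"
  shows "(mu_norm (Conv lam))\<^sup>2 = rho lam"
proof (rule antisym)
  obtain B where B: "\<And>k. cmod (lam k) \<le> B"
    using assms by (auto simp: bounded_iff)
  have "(mu_norm (Conv lam))\<^sup>2 \<le> sup_mean lam (Suc N)" for N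
  proof (rule LIMSEQ_le_const)
    let ?d = "\<lambda>J. 2*pi / real (Suc J)"
    let ?N = "real (Suc N)"
    have "?d \<longlonglongrightarrow> 0"
      using LIMSEQ_Suc[OF lim_const_over_n[of "2*pi"]] by simp
    then have "(\<lambda>J. sup_mean lam (Suc N) + 2 * B * (B * (?N * ?d J)) + (B * (?N * ?d J))\<^sup>2)
        \<longlonglongrightarrow> sup_mean lam (Suc N) + 2 * B * (B * (?N * 0)) + (B * (?N * 0))\<^sup>2"
      by (intro tendsto_add tendsto_mult tendsto_power tendsto_const)
    then show "(\<lambda>J. sup_mean lam (Suc N) + 2 * B * (B * (?N * ?d J)) + (B * (?N * ?d J))\<^sup>2)
        \<longlonglongrightarrow> sup_mean lam (Suc N)"
      by simp
    show "\<exists>J0. \<forall>J\<ge>J0. (mu_norm (Conv lam))\<^sup>2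
        \<le> sup_mean lam (Suc N) + 2 * B * (B * (?N * ?d J)) + (B * (?N * ?d J))\<^sup>2"
      using mu_norm_Conv_le[of lam B "Suc N" "Suc _", OF B] by blast
  qed
  then show "(mu_norm (Conv lam))\<^sup>2 \<le> rho lam"
    using LIMSEQ_Suc[OF sup_mean_tendsto_rho(1)[OF assms]] by (intro LIMSEQ_le_const) auto
next
  have "sqrt (rho lam) \<le> mu_norm (Conv lam)"
    unfolding mu_norm_def
  proof (rule cInf_greatest)
    show "{sqrt (M_part J Y (Conv lam)) |J Y. is_partition J Y} \<noteq> {}"
      using is_partition_arc[of 1] by auto
  qed (auto intro: M_part_ge_rho[OF assms])
  then have "(sqrt (rho lam))\<^sup>2 \<le> (mu_norm (Conv lam))\<^sup>2"
    by (intro power_mono) (simp_all add: sup_mean_tendsto_rho(3)[OF assms])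
  then show "rho lam \<le> (mu_norm (Conv lam))\<^sup>2"
    by (simp add: sup_mean_tendsto_rho(3)[OF assms])
qed

end
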